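(* Let $X$ be a transient Lévy process in $\mathbb{R}^d$, and suppose that $G^0(dz)$ has a density $G^0(z)$ with respect to the Lebesgue measure which is (essentially) unbounded and which is bounded on $\{|z|\ge r\}$ for every $r>0$. Then $\mathcal{K}^0(X)=\mathcal{K}(X)=\mathbb{K}(X)$.
   Context: All functions $q:\mathbb{R}^d\to\mathbb{R}$ are Borel. $\mathbb{P}^x,\mathbb{E}^x$ are the law and expectation of $X$ started at $x$; $B(x,r)$ is the open Euclidean ball. $G^0(B)=\int_0^\infty\mathbb{P}^0(X_u\in B)\,du$ is the potential measure. $\mathcal{K}^0(X)$ is the set of $q$ with $\lim_{r\to0^+}\sup_{x\in\mathbb{R}^d}\int_{B(0,r)}|q(z+x)|\,G^0(dz)=0$. $\mathbb{K}(X)$ is the set of $q$ with $\lim_{t\to0^+}\sup_x\mathbb{E}^x\int_0^t|q(X_u)|du=0$. $\mathcal{K}(X)$ is the set of $q$ such that for some (equivalently every) $\lambda>0$, $\lim_{r\to0^+}\sup_x\mathbb{E}^x\int_0^\infty e^{-\lambda u}\mathbf 1_{B(x,r)}(X_u)|q(X_u)|du=0$. *)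

theory Defs
  imports "HOL-Probability.Probability"
begin

definition cadlag :: "(real \<Rightarrow> 'a::topological_space) \<Rightarrow> bool" where
  "cadlag f \<longleftrightarrow>
     (\<forall>t\<ge>0. (f \<longlongrightarrow> f t) (at_right t)) \<and>
     (\<forall>t>0. \<exists>l. (f \<longlongrightarrow> l) (at_left t))"

text \<open>
  Time is \<^typ>\<open>real\<close>; only the values \<^term>\<open>X t\<close> with \<^prop>\<open>0 \<le> t\<close> are ever used.
  The process itself starts at the origin. The law of the process started at \<^term>\<open>x\<close> is
  that of \<open>x + X\<close>, so an expectation of a functional of the path under that law is written
  below as an integral over \<^term>\<open>M\<close> of the functional of \<open>x + X\<close>.
\<close>

locale levy_process = prob_space M
  for M :: "'w measure" and X :: "real \<Rightarrow> 'w \<Rightarrow> 'a::euclidean_space" +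
  assumes random_variable_process: "0 \<le> t \<Longrightarrow> random_variable borel (X t)"
    and start_0: "AE \<omega> in M. X 0 \<omega> = 0"
    and indep_increments:
      "0 \<le> s 0 \<Longrightarrow> (\<And>i. i < n \<Longrightarrow> s i < s (Suc i)) \<Longrightarrow>
         indep_vars (\<lambda>_. borel) (\<lambda>i \<omega>. X (s (Suc i)) \<omega> - X (s i) \<omega>) {..<n::nat}"
    and stationary_increments:
      "0 \<le> s' \<Longrightarrow> 0 \<le> t \<Longrightarrow>
         distr M borel (\<lambda>\<omega>. X (s' + t) \<omega> - X s' \<omega>) = distr M borel (X t)"
    and stochastically_continuous:
      "0 \<le> t \<Longrightarrow> 0 < \<epsilon> \<Longrightarrow>
         ((\<lambda>u. prob {\<omega> \<in> space M. \<epsilon> < dist (X u \<omega>) (X t \<omega>)}) \<longlongrightarrow> 0) (at t within {0..})"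
    and AE_cadlag: "AE \<omega> in M. cadlag (\<lambda>t. X t \<omega>)"

definition transient_process ::
    "'w measure \<Rightarrow> (real \<Rightarrow> 'w \<Rightarrow> 'a::real_normed_vector) \<Rightarrow> bool" where
  "transient_process M X \<longleftrightarrow> (AE \<omega> in M. filterlim (\<lambda>t. norm (X t \<omega>)) at_top at_top)"

definition potential_measure ::
    "'w measure \<Rightarrow> (real \<Rightarrow> 'w \<Rightarrow> 'a::euclidean_space) \<Rightarrow> 'a measure" where
  "potential_measure M X =
     measure_of UNIV (sets borel)
       (\<lambda>B. \<integral>\<^sup>+u\<in>{0..}. emeasure M {\<omega> \<in> space M. X u \<omega> \<in> B} \<partial>lborel)"

text \<open>\<^const>\<open>measure_of\<close> yields the zero measure unless the given set function is
  countably additive; the lemma \<open>emeasure_potential_measure\<close> confirms that it is.\<close>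

lemma (in levy_process) cadlag_modification:
  obtains Y where "\<And>t. 0 \<le> t \<Longrightarrow> Y t \<in> borel_measurable M"
    and "AE \<omega> in M. \<forall>t. X t \<omega> = Y t \<omega>" and "\<And>\<omega>. cadlag (\<lambda>t. Y t \<omega>)"
proof -
  obtain N where N: "{\<omega>\<in>space M. \<not> cadlag (\<lambda>t. X t \<omega>)} \<subseteq> N" "N \<in> null_sets M"
    using AE_cadlag by (auto elim!: AE_E)
  define Y where "Y t \<omega> = (if \<omega> \<in> space M - N then X t \<omega> else 0)" for t \<omega>
  have S: "space M - N \<in> sets M" using N by auto
  show thesis
  proof (rule that[of Y])
    fix t :: real assume "0 \<le> t"
    then have "X t \<in> borel_measurable M" by (rule random_variable_process)
    then show "Y t \<in> borel_measurable M"
      unfolding Y_def using S by (intro measurable_If_set) (auto simp: Int_absorb2 sets.sets_into_space)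
  next
    show "AE \<omega> in M. \<forall>t. X t \<omega> = Y t \<omega>"
      using AE_not_in[OF N(2)] AE_space by eventually_elim (auto simp: Y_def)
  next
    fix \<omega> show "cadlag (\<lambda>t. Y t \<omega>)"
    proof (cases "\<omega> \<in> space M - N")
      case True then have "cadlag (\<lambda>t. X t \<omega>)" using N by auto
      then show ?thesis using True by (simp add: Y_def)
    next
      case False then have "(\<lambda>t. Y t \<omega>) = (\<lambda>t. 0)" by (auto simp: Y_def)
      then show ?thesis by (auto simp: cadlag_def intro: tendsto_const)
    qed
  qed
qed

lemma cadlag_process_measurable_pair:
  fixes Y :: "real \<Rightarrow> 'w \<Rightarrow> 'a::euclidean_space"
  assumes Y: "\<And>t. 0 \<le> t \<Longrightarrow> Y t \<in> borel_measurable M" and cad: "\<And>\<omega>. cadlag (\<lambda>t. Y t \<omega>)"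
  shows "(\<lambda>(u, \<omega>). Y (max 0 u) \<omega>) \<in> borel_measurable (lborel \<Otimes>\<^sub>M M)"
proof (rule borel_measurable_LIMSEQ_metric)
  define a where "a n u = real (nat \<lfloor>real (Suc n) * max 0 u\<rfloor> + 1) / real (Suc n)" for n u
  fix n
  have "(\<lambda>(k, \<omega>). Y (real (k + 1) / real (Suc n)) \<omega>) \<in> borel_measurable (count_space UNIV \<Otimes>\<^sub>M M)"
    by (intro measurable_pair_measure_countable1) (auto intro!: Y simp del: of_nat_Suc)
  moreover have "(\<lambda>p. (nat \<lfloor>real (Suc n) * max 0 (fst p)\<rfloor>, snd p))
      \<in> measurable (lborel \<Otimes>\<^sub>M M) (count_space UNIV \<Otimes>\<^sub>M M)"
    by measurable
  ultimately have "(\<lambda>(k, \<omega>). Y (real (k + 1) / real (Suc n)) \<omega>) \<circ> 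
      (\<lambda>p. (nat \<lfloor>real (Suc n) * max 0 (fst p)\<rfloor>, snd p)) \<in> borel_measurable (lborel \<Otimes>\<^sub>M M)"
    by (rule measurable_comp[rotated])
  then show "(\<lambda>(u, \<omega>). Y (a n u) \<omega>) \<in> borel_measurable (lborel \<Otimes>\<^sub>M M)"
    by (simp add: comp_def case_prod_beta a_def)
next
  define a where "a n u = real (nat \<lfloor>real (Suc n) * max 0 u\<rfloor> + 1) / real (Suc n)" for n u
  fix p :: "real \<times> 'w"
  obtain u \<omega> where p: "p = (u, \<omega>)" by (cases p)
  define v where "v = max 0 u"
  have bnd: "v < a n u \<and> a n u \<le> v + 1 / real (Suc n)" for n
  proof -
    have "0 \<le> real (Suc n) * v" by (simp add: v_def)
    then have "real (nat \<lfloor>real (Suc n) * v\<rfloor>) = of_int \<lfloor>real (Suc n) * v\<rfloor>"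
      by (simp only: of_nat_nat zero_le_floor)
    then have "real (Suc n) * v < real (nat \<lfloor>real (Suc n) * v\<rfloor> + 1)"
      "real (nat \<lfloor>real (Suc n) * v\<rfloor> + 1) \<le> real (Suc n) * v + 1"
      by linarith+
    then show ?thesis
      unfolding a_def v_def[symmetric] by (simp add: field_simps del: of_nat_Suc)
  qed
  have "(\<lambda>n. a n u) \<longlonglongrightarrow> v"
  proof (rule tendsto_sandwich[of "\<lambda>_. v" _ _ "\<lambda>n. v + 1 / real (Suc n)"])
    show "(\<lambda>n. v + 1 / real (Suc n)) \<longlonglongrightarrow> v"
      using tendsto_add[OF tendsto_const LIMSEQ_inverse_real_of_nat] by (simp add: inverse_eq_divide)
    show "\<forall>\<^sub>F n in sequentially. v \<le> a n u"
      by (intro always_eventually allI less_imp_le conjunct1[OF bnd])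
    show "\<forall>\<^sub>F n in sequentially. a n u \<le> v + 1 / real (Suc n)"
      by (intro always_eventually allI conjunct2[OF bnd])
  qed simp
  then have "filterlim (\<lambda>n. a n u) (at_right v) sequentially"
    using bnd by (auto simp: filterlim_at intro!: always_eventually)
  moreover have "((\<lambda>t. Y t \<omega>) \<longlongrightarrow> Y v \<omega>) (at_right v)"
    using cad[of \<omega>] by (simp add: cadlag_def v_def)
  ultimately have "(\<lambda>n. Y (a n u) \<omega>) \<longlonglongrightarrow> Y v \<omega>"
    by (rule filterlim_compose[rotated])
  then show "(\<lambda>n. (\<lambda>(u, \<omega>). Y (real (nat \<lfloor>real (Suc n) * max 0 u\<rfloor> + 1) / real (Suc n)) \<omega>) p)
      \<longlonglongrightarrow> (\<lambda>(u, \<omega>). Y (max 0 u) \<omega>) p"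
    by (simp add: p a_def v_def)
qed

lemma sets_potential_measure [simp, measurable_cong]: "sets (potential_measure M X) = sets borel"
  by (simp add: potential_measure_def sets_measure_of_conv sets.sigma_sets_eq[of borel, simplified])

lemma (in levy_process) emeasure_potential_measure:
  assumes B: "B \<in> sets borel"
  shows "emeasure (potential_measure M X) B =
           (\<integral>\<^sup>+u\<in>{0..}. emeasure M {\<omega> \<in> space M. X u \<omega> \<in> B} \<partial>lborel)"
proof -
  obtain Y where Y: "\<And>t. 0 \<le> t \<Longrightarrow> Y t \<in> borel_measurable M"
    "AE \<omega> in M. \<forall>t. X t \<omega> = Y t \<omega>" "\<And>\<omega>. cadlag (\<lambda>t. Y t \<omega>)"
    using cadlag_modification by blast
  let ?Z = "\<lambda>(u, \<omega>). Y (max 0 u) \<omega>"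
  have Z[measurable]: "?Z \<in> borel_measurable (lborel \<Otimes>\<^sub>M M)"
    by (rule cadlag_process_measurable_pair[OF Y(1,3)])
  let ?D = "distr (density (lborel \<Otimes>\<^sub>M M) (\<lambda>p. indicator {0..} (fst p))) borel ?Z"
  have eq: "emeasure ?D A = (\<integral>\<^sup>+u\<in>{0..}. emeasure M {\<omega> \<in> space M. X u \<omega> \<in> A} \<partial>lborel)"
    if A[measurable]: "A \<in> sets borel" for A
  proof -
    have "emeasure ?D A =
        (\<integral>\<^sup>+p. indicator {0..} (fst p) * indicator (?Z -` A \<inter> space (lborel \<Otimes>\<^sub>M M)) p \<partial>(lborel \<Otimes>\<^sub>M M))"
    proof -
      have "?Z -` A \<inter> space (lborel \<Otimes>\<^sub>M M) \<in> sets (lborel \<Otimes>\<^sub>M M)"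
        by (rule measurable_sets[OF Z A])
      then show ?thesis
        by (subst emeasure_distr) (use Z in \<open>auto simp: emeasure_density\<close>)
    qed
    also have "\<dots> = (\<integral>\<^sup>+u. \<integral>\<^sup>+\<omega>. indicator {0..} u *
        indicator (?Z -` A \<inter> space (lborel \<Otimes>\<^sub>M M)) (u, \<omega>) \<partial>M \<partial>lborel)"
      by (subst nn_integral_fst[symmetric]) auto
    also have "\<dots> = (\<integral>\<^sup>+u\<in>{0..}. emeasure M {\<omega> \<in> space M. X u \<omega> \<in> A} \<partial>lborel)"
    proof (rule nn_integral_cong)
      fix u :: real
      show "(\<integral>\<^sup>+\<omega>. indicator {0..} u * indicator (?Z -` A \<inter> space (lborel \<Otimes>\<^sub>M M)) (u, \<omega>) \<partial>M)
        = emeasure M {\<omega> \<in> space M. X u \<omega> \<in> A} * indicator {0..} u"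
      proof (cases "0 \<le> u")
        case True
        note [measurable] = Y(1)[OF True] random_variable_process[OF True]
        have "(\<integral>\<^sup>+\<omega>. indicator (?Z -` A \<inter> space (lborel \<Otimes>\<^sub>M M)) (u, \<omega>) \<partial>M)
            = (\<integral>\<^sup>+\<omega>. indicator {\<omega> \<in> space M. Y u \<omega> \<in> A} \<omega> \<partial>M)"
          using True by (intro nn_integral_cong) (auto simp: space_pair_measure indicator_def)
        also have "\<dots> = emeasure M {\<omega> \<in> space M. Y u \<omega> \<in> A}" by simp
        also have "\<dots> = emeasure M {\<omega> \<in> space M. X u \<omega> \<in> A}"
          using Y(2) by (intro emeasure_eq_AE) auto
        finally show ?thesis using True by simp
      qed simp
    qed
    finally show ?thesis .
  qed
  have "potential_measure M X = measure_of UNIV (sets borel) (emeasure ?D)"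
    unfolding potential_measure_def
    by (intro measure_of_eq) (auto simp: eq sets.sigma_sets_eq[of borel, simplified])
  also have "\<dots> = ?D" using measure_of_of_measure[of ?D] by simp
  finally show ?thesis using eq[OF B] by simp
qed

definition kato_class_0 ::
    "'w measure \<Rightarrow> (real \<Rightarrow> 'w \<Rightarrow> 'a::euclidean_space) \<Rightarrow> ('a \<Rightarrow> real) set" where
  "kato_class_0 M X = {q \<in> borel_measurable borel.
     ((\<lambda>r. SUP x. \<integral>\<^sup>+z\<in>ball 0 r. ennreal \<bar>q (z + x)\<bar> \<partial>potential_measure M X) \<longlongrightarrow> 0) (at_right 0)}"

text \<open>The small-time Kato class, written with a blackboard-bold K.\<close>

definition kato_class_time ::
    "'w measure \<Rightarrow> (real \<Rightarrow> 'w \<Rightarrow> 'a::euclidean_space) \<Rightarrow> ('a \<Rightarrow> real) set" where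
  "kato_class_time M X = {q \<in> borel_measurable borel.
     ((\<lambda>t. SUP x. \<integral>\<^sup>+\<omega>. (\<integral>\<^sup>+u\<in>{0..t}. ennreal \<bar>q (x + X u \<omega>)\<bar> \<partial>lborel) \<partial>M)
        \<longlongrightarrow> 0) (at_right 0)}"

text \<open>The small-ball Kato class, written with a calligraphic K. The choice of
  the discount rate \<open>\<alpha>\<close> is immaterial, so one value suffices.\<close>

definition kato_class_space ::
    "'w measure \<Rightarrow> (real \<Rightarrow> 'w \<Rightarrow> 'a::euclidean_space) \<Rightarrow> ('a \<Rightarrow> real) set" where
  "kato_class_space M X = {q \<in> borel_measurable borel. \<exists>\<alpha>>0.
     ((\<lambda>r. SUP x. \<integral>\<^sup>+\<omega>. (\<integral>\<^sup>+u\<in>{0..}.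
          ennreal (exp (- \<alpha> * u)) * indicator (ball x r) (x + X u \<omega>) * ennreal \<bar>q (x + X u \<omega>)\<bar>
        \<partial>lborel) \<partial>M) \<longlongrightarrow> 0) (at_right 0)}"

end

theory Submission
  imports Defs "HOL-Real_Asymp.Real_Asymp"
begin

text \<open>
  Write \<open>U\<^sub>\<gamma>\<close> for the resolvent kernels and \<open>U\<^sub>0\<close> for the potential kernel; the three classes are
  shown to be cyclically included in each other.  Since \<open>U\<^sub>1 \<le> U\<^sub>0\<close>, smallness of the
  potential near the starting point gives smallness of the discounted potential.

  If \<open>U\<^sub>\<gamma>(1\<^bsub>B(x,r)\<^esub> |q|)(x) \<le> \<epsilon>\<close> for all \<open>x\<close>, then the contribution to \<open>U\<^sub>\<gamma> |q| (x)\<close> from outside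
  \<open>B(x,r)\<close> is by domination at most the supremum of \<open>U\<^sub>\<gamma> |q|\<close> times a factor that tends to 0 as
  \<open>\<gamma>\<close> grows, so that supremum is at most \<open>2 \<epsilon>\<close> for large \<open>\<gamma>\<close>, and this controls short times.

  For the remaining inclusion put \<open>f = 1\<^bsub>B(x,r)\<^esub> |q|\<close> and use \<open>U\<^sub>0 f = U\<^sub>\<beta> f + \<beta> U\<^sub>0 U\<^sub>\<beta> f\<close>.  If
  \<open>U\<^sub>\<beta> |q| \<le> \<epsilon>\<close>, the part of \<open>\<beta> U\<^sub>0 U\<^sub>\<beta> f (x)\<close> coming from a small ball around \<open>x\<close> is small because the
  potential measure has finite mass near the origin, and the rest is at most a constant times the
  Lebesgue integral of \<open>|q|\<close> over \<open>B(x,r)\<close>.  The latter tends to 0 because the \<open>\<beta>\<close>-potential of \<open>B(0,r)\<close>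
  is of larger order than its volume: otherwise the maximum principle would bound the density of
  \<open>U\<^sub>\<beta>\<close>, and then that of \<open>U\<^sub>0\<close>.
\<close>

section \<open>Limits at zero, absorption, and double integrals over time\<close>

text \<open>By monotonicity one good radius controls all smaller ones, so the limit of suprema
  becomes an epsilon bound uniform in \<open>x\<close>. The three classes are worked with in this
  form.\<close>

lemma tendsto_at_right_0_SUP_iff:
  fixes F :: "real \<Rightarrow> 'b \<Rightarrow> ennreal"
  assumes mono: "\<And>r s x. 0 < r \<Longrightarrow> r \<le> s \<Longrightarrow> F r x \<le> F s x"
  shows "((\<lambda>r. SUP x. F r x) \<longlongrightarrow> 0) (at_right 0) \<longleftrightarrow> (\<forall>e>0. \<exists>r>0. \<forall>x. F r x \<le> ennreal e)"
    (is "?L \<longleftrightarrow> ?R")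
proof
  assume L: ?L
  show ?R
  proof (intro allI impI)
    fix e :: real assume "e > 0"
    then have "\<forall>\<^sub>F r in at_right 0. (SUP x. F r x) < ennreal e"
      using L by (intro order_tendstoD(2)) auto
    then obtain b where b: "b > 0" "\<And>r. 0 < r \<Longrightarrow> r < b \<Longrightarrow> (SUP x. F r x) < ennreal e"
      unfolding eventually_at_right_field by auto
    have "F (b/2) x \<le> ennreal e" for x
      using b(2)[of "b/2"] b(1) SUP_upper[of x UNIV "F (b/2)"] by auto
    then show "\<exists>r>0. \<forall>x. F r x \<le> ennreal e" using b(1) by (intro exI[of _ "b/2"]) auto
  qed
next
  assume R: ?R
  show ?L
  proof (rule order_tendstoI)
    fix a :: ennreal assume "0 < a"
    then obtain c where c: "0 < c" "c < a" using dense by blast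
    define e where "e = enn2real c"
    have "c < top" using c(2) by (rule less_le_trans) simp
    then have ce: "c = ennreal e" "0 < e" using c(1)
      by (auto simp: e_def enn2real_positive_iff)
    then obtain r where r: "r > 0" "\<And>x. F r x \<le> c" using R by blast
    show "\<forall>\<^sub>F r in at_right 0. (SUP x. F r x) < a"
      unfolding eventually_at_right_field
    proof (intro exI[of _ r] conjI allI impI)
      fix s assume "0 < s" "s < r"
      then have "(SUP x. F s x) \<le> c" by (intro SUP_least order_trans[OF mono[of s r] r(2)]) auto
      then show "(SUP x. F s x) < a" using c(2) by (rule le_less_trans)
    qed (rule r)
  qed auto
qed

text \<open>The absorption step of the later estimates: half of \<open>S\<close> moves to the left.
  Finiteness is essential, since \<open>S = top\<close> satisfies the first hypothesis for every
  \<open>a\<close>.\<close>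

lemma ennreal_le_double_of_half:
  fixes S a :: ennreal
  assumes "S \<le> a + S / 2" "S < top"
  shows "S \<le> 2 * a"
proof (cases a)
  case (real r)
  from assms(2) obtain s where s: "S = ennreal s" "0 \<le> s" by (cases S) auto
  have "S / 2 = ennreal (s / 2)" using s by (simp add: divide_ennreal[symmetric])
  then have "s \<le> r + s / 2" using assms(1) s real by (simp flip: ennreal_plus)
  then have "ennreal s \<le> ennreal (2 * r)" using s by (intro ennreal_leI) auto
  then show ?thesis using s real by (simp add: ennreal_mult)
qed (simp add: ennreal_mult_top)

lemma nn_integral_exp_atLeast:
  fixes \<alpha> :: real
  assumes "\<alpha> > 0"
  shows "(\<integral>\<^sup>+u\<in>{0..}. ennreal (exp (- \<alpha> * u)) \<partial>lborel) = ennreal (1 / \<alpha>)"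
proof -
  have "(\<integral>\<^sup>+u. ennreal (exp (- \<alpha> * u)) * indicator {0..} u \<partial>lborel) = ennreal (0 - (- exp (- \<alpha> * 0) / \<alpha>))"
  proof (rule nn_integral_FTC_atLeast)
    show "((\<lambda>x. - exp (- \<alpha> * x) / \<alpha>) \<longlongrightarrow> 0) at_top"
      using assms by real_asymp
  qed (use assms in \<open>auto intro!: derivative_eq_intros\<close>)
  then show ?thesis by simp
qed

text \<open>All weights are brought inside the inner integral, the shape in which Fubini can
  exchange the two times.\<close>

lemma nn_integral_nested_time:
  fixes a :: "real \<Rightarrow> ennreal" and h :: "real \<Rightarrow> real \<Rightarrow> ennreal"
  assumes [measurable]: "(\<lambda>(s, t). h s t) \<in> borel_measurable (borel \<Otimes>\<^sub>M borel)"
  shows "(\<integral>\<^sup>+s\<in>{0..}. a s * (\<integral>\<^sup>+t\<in>{0..}. h s t \<partial>lborel) \<partial>lborel) =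
    (\<integral>\<^sup>+s. \<integral>\<^sup>+t. a s * indicator {0..} s * (h s t * indicator {0..} t) \<partial>lborel \<partial>lborel)"
proof (intro nn_integral_cong)
  fix s :: real
  have "(\<lambda>t. h s t * indicator {0..} t) \<in> borel_measurable lborel" by measurable
  then have "(\<integral>\<^sup>+t. a s * indicator {0..} s * (h s t * indicator {0..} t) \<partial>lborel) =
    a s * indicator {0..} s * (\<integral>\<^sup>+t\<in>{0..}. h s t \<partial>lborel)"
    by (rule nn_integral_cmult)
  then show "a s * (\<integral>\<^sup>+t\<in>{0..}. h s t \<partial>lborel) * indicator {0..} s =
    (\<integral>\<^sup>+t. a s * indicator {0..} s * (h s t * indicator {0..} t) \<partial>lborel)"
    by (simp only: mult_ac)
qed

text \<open>Substituting the total time \<open>v = s + t\<close> leaves the elementary integral of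
  \<open>exp ((\<beta> - \<alpha>) s)\<close> over \<open>{0..v}\<close>; this is the resolvent equation for a single orbit.\<close>

lemma resolvent_equation_time:
  fixes p :: "real \<Rightarrow> ennreal"
  assumes [measurable]: "p \<in> borel_measurable borel" and ab: "\<alpha> < \<beta>"
  shows "(\<integral>\<^sup>+v\<in>{0..}. ennreal (exp (- \<alpha> * v)) * p v \<partial>lborel) =
    (\<integral>\<^sup>+v\<in>{0..}. ennreal (exp (- \<beta> * v)) * p v \<partial>lborel) + ennreal (\<beta> - \<alpha>) *
    (\<integral>\<^sup>+s\<in>{0..}. ennreal (exp (- \<alpha> * s)) * (\<integral>\<^sup>+t\<in>{0..}. ennreal (exp (- \<beta> * t)) * p (s + t) \<partial>lborel) \<partial>lborel)"
proof -
  have "(\<integral>\<^sup>+s\<in>{0..}. ennreal (exp (- \<alpha> * s)) * (\<integral>\<^sup>+t\<in>{0..}. ennreal (exp (- \<beta> * t)) * p (s + t) \<partial>lborel) \<partial>lborel)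
    = (\<integral>\<^sup>+s. \<integral>\<^sup>+t. ennreal (exp (- \<alpha> * s)) * indicator {0..} s *
        (ennreal (exp (- \<beta> * t)) * p (s + t) * indicator {0..} t) \<partial>lborel \<partial>lborel)"
    by (rule nn_integral_nested_time) measurable
  also have "\<dots> = (\<integral>\<^sup>+s. \<integral>\<^sup>+v. ennreal (exp (- \<alpha> * s)) * indicator {0..} s *
        (ennreal (exp (- \<beta> * (v - s))) * p v * indicator {0..} (v - s)) \<partial>lborel \<partial>lborel)"
  proof (rule nn_integral_cong)
    fix s :: real
    show "(\<integral>\<^sup>+t. ennreal (exp (- \<alpha> * s)) * indicator {0..} s *
        (ennreal (exp (- \<beta> * t)) * p (s + t) * indicator {0..} t) \<partial>lborel) =
      (\<integral>\<^sup>+v. ennreal (exp (- \<alpha> * s)) * indicator {0..} s *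
        (ennreal (exp (- \<beta> * (v - s))) * p v * indicator {0..} (v - s)) \<partial>lborel)"
      by (subst nn_integral_real_affine[where c=1 and t="-s"]) auto
  qed
  also have "\<dots> = (\<integral>\<^sup>+v. \<integral>\<^sup>+s. ennreal (exp (- \<alpha> * s)) * indicator {0..} s *
        (ennreal (exp (- \<beta> * (v - s))) * p v * indicator {0..} (v - s)) \<partial>lborel \<partial>lborel)"
    by (rule lborel_pair.Fubini') measurable
  also have "\<dots> = (\<integral>\<^sup>+v. ennreal (exp (- \<beta> * v)) * indicator {0..} v * p v *
      (\<integral>\<^sup>+s. ennreal (exp ((\<beta> - \<alpha>) * s)) * indicator {0..v} s \<partial>lborel) \<partial>lborel)"
  proof (rule nn_integral_cong)
    fix v :: real
    have "ennreal (exp (- \<alpha> * s)) * indicator {0..} s * (ennreal (exp (- \<beta> * (v - s))) * p v * indicator {0..} (v - s)) =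
      ennreal (exp (- \<beta> * v)) * indicator {0..} v * p v * (ennreal (exp ((\<beta> - \<alpha>) * s)) * indicator {0..v} s)" for s
    proof (cases "0 \<le> s \<and> s \<le> v")
      case True
      \<comment> \<open>The exponent separates into a term in \<open>v\<close> and a term in
        \<open>s\<close>, and the two indicators leave \<open>0 \<le> s \<le> v\<close>.\<close>
      have "- \<alpha> * s + - \<beta> * (v - s) = - \<beta> * v + (\<beta> - \<alpha>) * s" by algebra
      then have "ennreal (exp (- \<alpha> * s)) * ennreal (exp (- \<beta> * (v - s))) =
          ennreal (exp (- \<beta> * v)) * ennreal (exp ((\<beta> - \<alpha>) * s))"
        by (simp only: ennreal_mult[symmetric] exp_ge_zero exp_add[symmetric])
      then have "p v * (ennreal (exp (- \<alpha> * s)) * ennreal (exp (- \<beta> * (v - s)))) =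
          p v * (ennreal (exp (- \<beta> * v)) * ennreal (exp ((\<beta> - \<alpha>) * s)))"
        by (simp only:)
      then show ?thesis using True by (simp add: mult_ac)
    qed (auto simp: indicator_def)
    then have "(\<integral>\<^sup>+s. ennreal (exp (- \<alpha> * s)) * indicator {0..} s * (ennreal (exp (- \<beta> * (v - s))) * p v * indicator {0..} (v - s)) \<partial>lborel) =
      (\<integral>\<^sup>+s. ennreal (exp (- \<beta> * v)) * indicator {0..} v * p v * (ennreal (exp ((\<beta> - \<alpha>) * s)) * indicator {0..v} s) \<partial>lborel)"
      by (simp only:)
    also have "\<dots> = ennreal (exp (- \<beta> * v)) * indicator {0..} v * p v *
        (\<integral>\<^sup>+s. ennreal (exp ((\<beta> - \<alpha>) * s)) * indicator {0..v} s \<partial>lborel)"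
      by (rule nn_integral_cmult) measurable
    finally show "(\<integral>\<^sup>+s. ennreal (exp (- \<alpha> * s)) * indicator {0..} s * (ennreal (exp (- \<beta> * (v - s))) * p v * indicator {0..} (v - s)) \<partial>lborel) = \<dots>" .
  qed
  also have "\<dots> = (\<integral>\<^sup>+v. ennreal (exp (- \<beta> * v)) * indicator {0..} v * p v *
      ennreal ((exp ((\<beta> - \<alpha>) * v) - 1) / (\<beta> - \<alpha>)) \<partial>lborel)"
  proof (intro nn_integral_cong)
    fix v :: real
    show "ennreal (exp (- \<beta> * v)) * indicator {0..} v * p v *
      (\<integral>\<^sup>+s. ennreal (exp ((\<beta> - \<alpha>) * s)) * indicator {0..v} s \<partial>lborel) =
      ennreal (exp (- \<beta> * v)) * indicator {0..} v * p v * ennreal ((exp ((\<beta> - \<alpha>) * v) - 1) / (\<beta> - \<alpha>))"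
    proof (cases "0 \<le> v")
      case True
      have "(\<integral>\<^sup>+s. ennreal (exp ((\<beta> - \<alpha>) * s)) * indicator {0..v} s \<partial>lborel)
        = ennreal (exp ((\<beta> - \<alpha>) * v) / (\<beta> - \<alpha>) - exp ((\<beta> - \<alpha>) * 0) / (\<beta> - \<alpha>))"
        using ab True by (intro nn_integral_FTC_Icc) (auto intro!: derivative_eq_intros)
      then show ?thesis by (simp add: diff_divide_distrib)
    qed simp
  qed
  finally have J: "(\<integral>\<^sup>+s\<in>{0..}. ennreal (exp (- \<alpha> * s)) * (\<integral>\<^sup>+t\<in>{0..}. ennreal (exp (- \<beta> * t)) * p (s + t) \<partial>lborel) \<partial>lborel)
    = (\<integral>\<^sup>+v. ennreal (exp (- \<beta> * v)) * indicator {0..} v * p v *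
      ennreal ((exp ((\<beta> - \<alpha>) * v) - 1) / (\<beta> - \<alpha>)) \<partial>lborel)" .
  show ?thesis
    unfolding J
  proof (subst nn_integral_cmult[symmetric], measurable, subst nn_integral_add[symmetric], measurable, intro nn_integral_cong)
    fix v :: real
    show "ennreal (exp (- \<alpha> * v)) * p v * indicator {0..} v =
      ennreal (exp (- \<beta> * v)) * p v * indicator {0..} v + ennreal (\<beta> - \<alpha>) * (ennreal (exp (- \<beta> * v)) *
       indicator {0..} v * p v * ennreal ((exp ((\<beta> - \<alpha>) * v) - 1) / (\<beta> - \<alpha>)))"
    proof (cases "0 \<le> v")
      case True
      define E where "E = exp ((\<beta> - \<alpha>) * v)"
      have "- \<alpha> * v = - \<beta> * v + (\<beta> - \<alpha>) * v" by algebra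
      then have E: "exp (- \<alpha> * v) = exp (- \<beta> * v) * E" "1 \<le> E"
        using ab True by (simp_all add: E_def exp_add[symmetric])
      \<comment> \<open>\<open>F\<close> is the inner integral of
        \<open>exp ((\<beta> - \<alpha>) * s)\<close> over \<open>{0..v}\<close>; the identity
        \<open>E = 1 + (\<beta> - \<alpha>) * F\<close> is the resolvent equation pointwise in
        \<open>v\<close>.\<close>
      define F where "F = (E - 1) / (\<beta> - \<alpha>)"
      have F: "0 \<le> F" using ab E(2) by (simp add: F_def)
      have EF: "E = 1 + (\<beta> - \<alpha>) * F" using ab by (simp add: F_def)
      have "exp (- \<alpha> * v) = exp (- \<beta> * v) + (\<beta> - \<alpha>) * (exp (- \<beta> * v) * F)"
        unfolding E(1) by (subst EF) (simp add: algebra_simps)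
      then have "ennreal (exp (- \<alpha> * v)) = ennreal (exp (- \<beta> * v) + (\<beta> - \<alpha>) * (exp (- \<beta> * v) * F))"
        by (simp only:)
      also have "\<dots> = ennreal (exp (- \<beta> * v)) + ennreal (\<beta> - \<alpha>) * (ennreal (exp (- \<beta> * v)) * ennreal F)"
        using ab F by (simp add: ennreal_mult)
      finally have "ennreal (exp (- \<alpha> * v)) = ennreal (exp (- \<beta> * v)) +
        ennreal (\<beta> - \<alpha>) * (ennreal (exp (- \<beta> * v)) * ennreal ((exp ((\<beta> - \<alpha>) * v) - 1) / (\<beta> - \<alpha>)))"
        unfolding F_def E_def .
      then show ?thesis using True by (simp add: distrib_left distrib_right mult_ac)
    qed simp
  qed
qed

text \<open>Apart from the two exponential weights the integrand depends only on
  \<open>s + t\<close>, so exchanging the order of integration and renaming the times exchanges the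
  rates.\<close>

lemma nn_integral_time_swap:
  fixes p :: "real \<Rightarrow> ennreal"
  assumes [measurable]: "p \<in> borel_measurable borel"
  shows "(\<integral>\<^sup>+s\<in>{0..}. ennreal (exp (- \<alpha> * s)) * (\<integral>\<^sup>+t\<in>{0..}. ennreal (exp (- \<beta> * t)) * p (s + t) \<partial>lborel) \<partial>lborel)
   = (\<integral>\<^sup>+s\<in>{0..}. ennreal (exp (- \<beta> * s)) * (\<integral>\<^sup>+t\<in>{0..}. ennreal (exp (- \<alpha> * t)) * p (s + t) \<partial>lborel) \<partial>lborel)"
proof -
  have *: "(\<integral>\<^sup>+s\<in>{0..}. ennreal (exp (- \<alpha> * s)) * (\<integral>\<^sup>+t\<in>{0..}. ennreal (exp (- \<beta> * t)) * p (s + t) \<partial>lborel) \<partial>lborel)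
    = (\<integral>\<^sup>+s. \<integral>\<^sup>+t. ennreal (exp (- \<alpha> * s)) * indicator {0..} s *
        (ennreal (exp (- \<beta> * t)) * p (s + t) * indicator {0..} t) \<partial>lborel \<partial>lborel)" for \<alpha> \<beta> :: real
    by (rule nn_integral_nested_time) measurable
  show ?thesis
    unfolding *[of \<alpha> \<beta>] *[of \<beta> \<alpha>]
    by (subst lborel_pair.Fubini') (auto intro!: nn_integral_cong simp: mult_ac add.commute)
qed

section \<open>Resolvent measures\<close>

context levy_process
begin

section \<open>A jointly measurable version of the paths and the resolvent measures\<close>

text \<open>Choice fixes one version once and for all, so that the resolvent measures can be defined
  outright.\<close>

definition cadlag_version :: "real \<Rightarrow> 'w \<Rightarrow> 'a" where
  "cadlag_version = (SOME Y. (\<forall>t\<ge>0. Y t \<in> borel_measurable M) \<and>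
     (AE \<omega> in M. \<forall>t. X t \<omega> = Y t \<omega>) \<and> (\<forall>\<omega>. cadlag (\<lambda>t. Y t \<omega>)))"

lemma cadlag_version:
  shows "0 \<le> t \<Longrightarrow> cadlag_version t \<in> borel_measurable M"
    and "AE \<omega> in M. \<forall>t. X t \<omega> = cadlag_version t \<omega>"
    and "cadlag (\<lambda>t. cadlag_version t \<omega>)"
proof -
  have "\<exists>Y. (\<forall>t\<ge>0. Y t \<in> borel_measurable M) \<and>
     (AE \<omega> in M. \<forall>t. X t \<omega> = Y t \<omega>) \<and> (\<forall>\<omega>. cadlag (\<lambda>t. Y t \<omega>))"
    using cadlag_modification by metis
  from someI_ex[OF this, folded cadlag_version_def]
  show "0 \<le> t \<Longrightarrow> cadlag_version t \<in> borel_measurable M"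
    and "AE \<omega> in M. \<forall>t. X t \<omega> = cadlag_version t \<omega>"
    and "cadlag (\<lambda>t. cadlag_version t \<omega>)"
    by auto
qed

text \<open>Negative times are clamped to 0, which makes the map jointly measurable on the whole
  time line; at times \<open>0 \<le> t\<close> it agrees with \<open>X\<close> off a single null
  set.\<close>

definition path :: "real \<Rightarrow> 'w \<Rightarrow> 'a" where
  "path u \<omega> = cadlag_version (max 0 u) \<omega>"

lemma measurable_path [measurable]: "(\<lambda>(u, \<omega>). path u \<omega>) \<in> borel_measurable (lborel \<Otimes>\<^sub>M M)"
  unfolding path_def by (rule cadlag_process_measurable_pair[OF cadlag_version(1,3)])

lemma AE_path: "AE \<omega> in M. \<forall>t\<ge>0. X t \<omega> = path t \<omega>"
  using cadlag_version(2) by eventually_elim (simp add: path_def)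

text \<open>The discounted occupation measure of the process started at 0, encoded as an image
  measure so that countable additivity is automatic. Rate 0 gives the potential measure.\<close>

definition resolvent :: "real \<Rightarrow> 'a measure" where
  "resolvent \<alpha> = distr (density (lborel \<Otimes>\<^sub>M M) (\<lambda>(u, \<omega>). indicator {0..} u * ennreal (exp (- \<alpha> * u))))
     borel (\<lambda>(u, \<omega>). path u \<omega>)"

lemma sets_resolvent [simp, measurable_cong]: "sets (resolvent \<alpha>) = sets borel"
  by (simp add: resolvent_def)

lemma space_resolvent [simp]: "space (resolvent \<alpha>) = UNIV"
  by (simp add: resolvent_def)

lemma nn_integral_path:
  assumes "0 \<le> t" 
  shows "(\<integral>\<^sup>+\<omega>. f (path t \<omega>) \<partial>M) = (\<integral>\<^sup>+\<omega>. f (X t \<omega>) \<partial>M)"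
  using AE_path by (intro nn_integral_cong_AE, eventually_elim) (use assms in auto)

text \<open>Fubini is applied to \<open>path\<close>, which is jointly measurable, and the result is
  transferred to \<open>X\<close>. The general weight \<open>h\<close> covers both the discount
  factor and the restriction to a bounded time window.\<close>

lemma nn_integral_weighted_time:
  fixes f :: "'a \<Rightarrow> ennreal" and h :: "real \<Rightarrow> ennreal"
  assumes [measurable]: "f \<in> borel_measurable borel" "h \<in> borel_measurable borel"
  shows "(\<integral>\<^sup>+\<omega>. (\<integral>\<^sup>+u\<in>{0..}. h u * f (X u \<omega>) \<partial>lborel) \<partial>M) =
    (\<integral>\<^sup>+u\<in>{0..}. h u * (\<integral>\<^sup>+\<omega>. f (X u \<omega>) \<partial>M) \<partial>lborel)"
proof -
  interpret pair_sigma_finite lborel M ..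
  have "(\<integral>\<^sup>+\<omega>. (\<integral>\<^sup>+u\<in>{0..}. h u * f (X u \<omega>) \<partial>lborel) \<partial>M) =
    (\<integral>\<^sup>+\<omega>. (\<integral>\<^sup>+u. h u * f (path u \<omega>) * indicator {0..} u \<partial>lborel) \<partial>M)"
    by (intro nn_integral_cong_AE, rule AE_mp[OF AE_path], intro AE_I2 impI nn_integral_cong)
       (auto simp: indicator_def)
  also have "\<dots> = (\<integral>\<^sup>+u. (\<integral>\<^sup>+\<omega>. h u * f (path u \<omega>) * indicator {0..} u \<partial>M) \<partial>lborel)"
    by (rule Fubini') measurable
  also have "\<dots> = (\<integral>\<^sup>+u\<in>{0..}. h u * (\<integral>\<^sup>+\<omega>. f (X u \<omega>) \<partial>M) \<partial>lborel)"
  proof (intro nn_integral_cong)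
    fix u :: real
    show "(\<integral>\<^sup>+\<omega>. h u * f (path u \<omega>) * indicator {0..} u \<partial>M) = 
      h u * (\<integral>\<^sup>+\<omega>. f (X u \<omega>) \<partial>M) * indicator {0..} u"
    proof (cases "0 \<le> u")
      case True
      have "(\<lambda>\<omega>. f (path u \<omega>)) \<in> borel_measurable M" by measurable
      with True show ?thesis by (simp add: nn_integral_cmult nn_integral_path)
    qed simp
  qed
  finally show ?thesis .
qed

lemma nn_integral_resolvent:
  fixes f :: "'a \<Rightarrow> ennreal"
  assumes [measurable]: "f \<in> borel_measurable borel"
  shows "(\<integral>\<^sup>+z. f z \<partial>resolvent \<alpha>) =
    (\<integral>\<^sup>+u\<in>{0..}. ennreal (exp (- \<alpha> * u)) * (\<integral>\<^sup>+\<omega>. f (X u \<omega>) \<partial>M) \<partial>lborel)"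
proof -
  have "(\<integral>\<^sup>+z. f z \<partial>resolvent \<alpha>) = (\<integral>\<^sup>+p. (case p of (u, \<omega>) \<Rightarrow> indicator {0..} u * ennreal (exp (- \<alpha> * u))) *
      f (case p of (u, \<omega>) \<Rightarrow> path u \<omega>) \<partial>(lborel \<Otimes>\<^sub>M M))"
    unfolding resolvent_def by (subst nn_integral_distr) (auto simp: nn_integral_density)
  also have "\<dots> = (\<integral>\<^sup>+u. \<integral>\<^sup>+\<omega>. indicator {0..} u * ennreal (exp (- \<alpha> * u)) * f (path u \<omega>) \<partial>M \<partial>lborel)"
    by (subst nn_integral_fst[symmetric]) auto
  also have "\<dots> = (\<integral>\<^sup>+u\<in>{0..}. ennreal (exp (- \<alpha> * u)) * (\<integral>\<^sup>+\<omega>. f (X u \<omega>) \<partial>M) \<partial>lborel)"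
  proof (intro nn_integral_cong)
    fix u :: real
    show "(\<integral>\<^sup>+\<omega>. indicator {0..} u * ennreal (exp (- \<alpha> * u)) * f (path u \<omega>) \<partial>M) = 
      ennreal (exp (- \<alpha> * u)) * (\<integral>\<^sup>+\<omega>. f (X u \<omega>) \<partial>M) * indicator {0..} u"
    proof (cases "0 \<le> u")
      case True
      have "(\<lambda>\<omega>. f (path u \<omega>)) \<in> borel_measurable M" by measurable
      with True show ?thesis by (simp add: nn_integral_cmult nn_integral_path)
    qed simp
  qed
  finally show ?thesis .
qed

lemma potential_measure_eq_resolvent: "potential_measure M X = resolvent 0"
proof (rule measure_eqI)
  fix B assume "B \<in> sets (potential_measure M X)"
  then have B[measurable]: "B \<in> sets borel" by simp
  have "emeasure (resolvent 0) B = (\<integral>\<^sup>+z. indicator B z \<partial>resolvent 0)" by simp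
  also have "\<dots> = (\<integral>\<^sup>+u\<in>{0..}. emeasure M {\<omega> \<in> space M. X u \<omega> \<in> B} \<partial>lborel)"
    unfolding nn_integral_resolvent[OF borel_measurable_indicator[OF B]]
  proof (intro nn_integral_cong)
    fix u :: real
    show "ennreal (exp (- 0 * u)) * (\<integral>\<^sup>+\<omega>. indicator B (X u \<omega>) \<partial>M) * indicator {0..} u = 
      emeasure M {\<omega> \<in> space M. X u \<omega> \<in> B} * indicator {0..} u"
    proof (cases "0 \<le> u")
      case True
      note [measurable] = random_variable_process[OF True]
      have "(\<integral>\<^sup>+\<omega>. indicator B (X u \<omega>) \<partial>M) = (\<integral>\<^sup>+\<omega>. indicator {\<omega> \<in> space M. X u \<omega> \<in> B} \<omega> \<partial>M)"
        by (intro nn_integral_cong) (auto simp: indicator_def)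
      also have "\<dots> = emeasure M {\<omega> \<in> space M. X u \<omega> \<in> B}" by simp
      finally show ?thesis by simp
    qed simp
  qed
  finally show "emeasure (potential_measure M X) B = emeasure (resolvent 0) B"
    by (simp add: emeasure_potential_measure)
qed simp

lemma emeasure_resolvent_UNIV:
  assumes "\<alpha> > 0" shows "emeasure (resolvent \<alpha>) UNIV = ennreal (1 / \<alpha>)"
proof -
  have "emeasure (resolvent \<alpha>) UNIV = (\<integral>\<^sup>+z. 1 \<partial>resolvent \<alpha>)" by simp
  also have "\<dots> = ennreal (1 / \<alpha>)"
    by (subst nn_integral_resolvent) (auto simp: emeasure_space_1 nn_integral_exp_atLeast[OF assms, simplified])
  finally show ?thesis .
qed

lemma finite_measure_resolvent: "\<alpha> > 0 \<Longrightarrow> finite_measure (resolvent \<alpha>)"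
  by (rule finite_measureI) (simp add: emeasure_resolvent_UNIV)

section \<open>Semigroup property and resolvent equation\<close>

text \<open>\<open>X (s + t)\<close> is \<open>X s\<close> plus an increment that is independent of
  \<open>X s\<close> and has the law of \<open>X t\<close>. All later uses of the Markov property go
  through this identity.\<close>

lemma nn_integral_semigroup:
  fixes f :: "'a \<Rightarrow> ennreal"
  assumes f[measurable]: "f \<in> borel_measurable borel" and s: "0 < s" and t: "0 < t"
  shows "(\<integral>\<^sup>+\<omega>. f (X (s + t) \<omega>) \<partial>M) = (\<integral>\<^sup>+\<omega>. (\<integral>\<^sup>+\<omega>'. f (X s \<omega> + X t \<omega>') \<partial>M) \<partial>M)"
proof -
  have [measurable]: "X 0 \<in> borel_measurable M" "X s \<in> borel_measurable M" "X t \<in> borel_measurable M" "X (s + t) \<in> borel_measurable M"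
    using s t by (auto intro: random_variable_process)
  \<comment> \<open>Independence is available for increments over strictly increasing times, so
    \<open>X s\<close> enters as \<open>X s - X 0\<close>, which equals it almost surely.\<close>
  define c :: "nat \<Rightarrow> real" where "c i = (if i = 0 then 0 else if i = 1 then s else s + t)" for i
  have "indep_vars (\<lambda>_. borel) (\<lambda>i \<omega>. X (c (Suc i)) \<omega> - X (c i) \<omega>) {..<2}"
    by (rule indep_increments) (use s t in \<open>auto simp: c_def less_Suc_eq numeral_2_eq_2\<close>)
  then have "indep_var (PiM {0} (\<lambda>_. borel)) (\<lambda>\<omega>. restrict (\<lambda>i. X (c (Suc i)) \<omega> - X (c i) \<omega>) {0})
      (PiM {1} (\<lambda>_. borel)) (\<lambda>\<omega>. restrict (\<lambda>i. X (c (Suc i)) \<omega> - X (c i) \<omega>) {1::nat})"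
    by (rule indep_var_restrict) auto
  then have "indep_var borel ((\<lambda>f. f 0) \<circ> (\<lambda>\<omega>. restrict (\<lambda>i. X (c (Suc i)) \<omega> - X (c i) \<omega>) {0}))
      borel ((\<lambda>f. f 1) \<circ> (\<lambda>\<omega>. restrict (\<lambda>i. X (c (Suc i)) \<omega> - X (c i) \<omega>) {1::nat}))"
    by (rule indep_var_compose) auto
  then have iv: "indep_var borel (\<lambda>\<omega>. X s \<omega> - X 0 \<omega>) borel (\<lambda>\<omega>. X (s + t) \<omega> - X s \<omega>)"
    by (simp add: comp_def c_def)
  have d: "distr M borel (\<lambda>\<omega>. X s \<omega> - X 0 \<omega>) = distr M borel (X s)"
    using start_0 by (intro distr_cong_AE) auto
  have "distr M borel (X s) \<Otimes>\<^sub>M distr M borel (X t) =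
      distr M (borel \<Otimes>\<^sub>M borel) (\<lambda>\<omega>. (X s \<omega> - X 0 \<omega>, X (s + t) \<omega> - X s \<omega>))"
    using iv d stationary_increments[of s t] s t
    by (simp add: indep_var_distribution_eq del: borel_prod)
  also have "\<dots> = distr M (borel \<Otimes>\<^sub>M borel) (\<lambda>\<omega>. (X s \<omega>, X (s + t) \<omega> - X s \<omega>))"
    using start_0 by (intro distr_cong_AE) auto
  finally have eq: "distr M borel (X s) \<Otimes>\<^sub>M distr M borel (X t) = \<dots>" .
  interpret T: prob_space "distr M borel (X t)" by (rule prob_space_distr) simp
  have "(\<integral>\<^sup>+\<omega>. f (X (s + t) \<omega>) \<partial>M) = (\<integral>\<^sup>+p. f (fst p + snd p) \<partial>distr M (borel \<Otimes>\<^sub>M borel) (\<lambda>\<omega>. (X s \<omega>, X (s + t) \<omega> - X s \<omega>)))"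
    by (subst nn_integral_distr) auto
  also have "\<dots> = (\<integral>\<^sup>+y. \<integral>\<^sup>+z. f (y + z) \<partial>distr M borel (X t) \<partial>distr M borel (X s))"
    unfolding eq[symmetric] by (subst T.nn_integral_fst[symmetric]) auto
  also have "\<dots> = (\<integral>\<^sup>+\<omega>. (\<integral>\<^sup>+z. f (X s \<omega> + z) \<partial>distr M borel (X t)) \<partial>M)"
    by (subst nn_integral_distr) auto
  also have "\<dots> = (\<integral>\<^sup>+\<omega>. (\<integral>\<^sup>+\<omega>'. f (X s \<omega> + X t \<omega>') \<partial>M) \<partial>M)"
    by (intro nn_integral_cong nn_integral_distr) auto
  finally show ?thesis .
qed

lemma borel_measurable_resolvent_translate [measurable]:
  fixes f :: "'a \<Rightarrow> ennreal"
  assumes [measurable]: "f \<in> borel_measurable borel" and "\<beta> > 0"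
  shows "(\<lambda>x. \<integral>\<^sup>+z. f (x + z) \<partial>resolvent \<beta>) \<in> borel_measurable borel"
proof -
  interpret R: finite_measure "resolvent \<beta>" by (rule finite_measure_resolvent) fact
  show ?thesis by measurable
qed

lemma nn_integral_shift_time:
  fixes f :: "'a \<Rightarrow> ennreal"
  assumes f[measurable]: "f \<in> borel_measurable borel" and s: "0 < s" 
  shows "(\<integral>\<^sup>+\<omega>. (\<integral>\<^sup>+z. f (X s \<omega> + z) \<partial>resolvent \<beta>) \<partial>M) =
    (\<integral>\<^sup>+t\<in>{0..}. ennreal (exp (- \<beta> * t)) * (\<integral>\<^sup>+\<omega>. f (X (s + t) \<omega>) \<partial>M) \<partial>lborel)"
proof -
  interpret pair_sigma_finite M lborel ..
  have [measurable]: "X s \<in> borel_measurable M" using s by (auto intro: random_variable_process)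
  have "(\<integral>\<^sup>+\<omega>. (\<integral>\<^sup>+z. f (X s \<omega> + z) \<partial>resolvent \<beta>) \<partial>M) =
    (\<integral>\<^sup>+\<omega>. (\<integral>\<^sup>+t. ennreal (exp (- \<beta> * t)) * (\<integral>\<^sup>+\<omega>'. f (X s \<omega> + path t \<omega>') \<partial>M) * indicator {0..} t \<partial>lborel) \<partial>M)"
    by (intro nn_integral_cong, subst nn_integral_resolvent)
       (auto intro!: nn_integral_cong simp: indicator_def nn_integral_path[where f="\<lambda>y. f (_ + y)"])
  also have "\<dots> = (\<integral>\<^sup>+t. (\<integral>\<^sup>+\<omega>. ennreal (exp (- \<beta> * t)) * (\<integral>\<^sup>+\<omega>'. f (X s \<omega> + path t \<omega>') \<partial>M) * indicator {0..} t \<partial>M) \<partial>lborel)"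
    by (rule Fubini'[symmetric]) measurable
  also have "\<dots> = (\<integral>\<^sup>+t\<in>{0..}. ennreal (exp (- \<beta> * t)) * (\<integral>\<^sup>+\<omega>. f (X (s + t) \<omega>) \<partial>M) \<partial>lborel)"
  proof (intro nn_integral_cong_AE)
    \<comment> \<open>The semigroup identity is stated for positive times, so the single time 0 is
      discarded as a null set.\<close>
    have "AE t in lborel. t \<noteq> (0::real)" by (rule AE_lborel_singleton)
    then show "AE t in lborel. (\<integral>\<^sup>+\<omega>. ennreal (exp (- \<beta> * t)) * (\<integral>\<^sup>+\<omega>'. f (X s \<omega> + path t \<omega>') \<partial>M) * indicator {0..} t \<partial>M)
      = ennreal (exp (- \<beta> * t)) * (\<integral>\<^sup>+\<omega>. f (X (s + t) \<omega>) \<partial>M) * indicator {0..} t"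
    proof eventually_elim
      case (elim t)
      show ?case
      proof (cases "0 < t")
        case True
        have [measurable]: "X t \<in> borel_measurable M" using True by (auto intro: random_variable_process)
        show ?thesis using True nn_integral_semigroup[OF f s True]
          by (simp add: nn_integral_cmult nn_integral_path[where f="\<lambda>y. f (_ + y)"])
      next
        case False
        with elim show ?thesis by simp
      qed
    qed
  qed
  finally show ?thesis .
qed

text \<open>The semigroup turns the composition of two kernels into a double time integral of a
  function of \<open>s + t\<close>, to which the deterministic identities apply. \<open>path\<close>
  replaces \<open>X\<close> to make the expectation measurable in time.\<close>

lemma nn_integral_resolvent_resolvent:
  fixes f :: "'a \<Rightarrow> ennreal"
  assumes f[measurable]: "f \<in> borel_measurable borel" and b: "\<beta> > 0"
  shows "(\<integral>\<^sup>+y. (\<integral>\<^sup>+z. f (y + z) \<partial>resolvent \<beta>) \<partial>resolvent \<alpha>) =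
    (\<integral>\<^sup>+s\<in>{0..}. ennreal (exp (- \<alpha> * s)) * (\<integral>\<^sup>+t\<in>{0..}. ennreal (exp (- \<beta> * t)) * (\<integral>\<^sup>+\<omega>. f (path (s + t) \<omega>) \<partial>M) \<partial>lborel) \<partial>lborel)"
proof -
  have "(\<integral>\<^sup>+y. (\<integral>\<^sup>+z. f (y + z) \<partial>resolvent \<beta>) \<partial>resolvent \<alpha>) =
    (\<integral>\<^sup>+s\<in>{0..}. ennreal (exp (- \<alpha> * s)) * (\<integral>\<^sup>+\<omega>. (\<integral>\<^sup>+z. f (X s \<omega> + z) \<partial>resolvent \<beta>) \<partial>M) \<partial>lborel)"
    using b by (intro nn_integral_resolvent) measurable
  also have "\<dots> = (\<integral>\<^sup>+s\<in>{0..}. ennreal (exp (- \<alpha> * s)) * (\<integral>\<^sup>+t\<in>{0..}. ennreal (exp (- \<beta> * t)) * (\<integral>\<^sup>+\<omega>. f (path (s + t) \<omega>) \<partial>M) \<partial>lborel) \<partial>lborel)"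
  proof (intro nn_integral_cong_AE)
    have "AE t in lborel. t \<noteq> (0::real)" by (rule AE_lborel_singleton)
    then show "AE s in lborel. ennreal (exp (- \<alpha> * s)) * (\<integral>\<^sup>+\<omega>. (\<integral>\<^sup>+z. f (X s \<omega> + z) \<partial>resolvent \<beta>) \<partial>M) * indicator {0..} s =
      ennreal (exp (- \<alpha> * s)) * (\<integral>\<^sup>+t\<in>{0..}. ennreal (exp (- \<beta> * t)) * (\<integral>\<^sup>+\<omega>. f (path (s + t) \<omega>) \<partial>M) \<partial>lborel) * indicator {0..} s"
    proof eventually_elim
      case (elim s)
      show ?case
      proof (cases "0 < s")
        case True
        have "(\<integral>\<^sup>+t\<in>{0..}. ennreal (exp (- \<beta> * t)) * (\<integral>\<^sup>+\<omega>. f (X (s + t) \<omega>) \<partial>M) \<partial>lborel) =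
          (\<integral>\<^sup>+t\<in>{0..}. ennreal (exp (- \<beta> * t)) * (\<integral>\<^sup>+\<omega>. f (path (s + t) \<omega>) \<partial>M) \<partial>lborel)"
          using True by (intro nn_integral_cong) (auto simp: indicator_def nn_integral_path)
        then show ?thesis by (simp add: nn_integral_shift_time[OF f True])
      next
        case False
        with elim show ?thesis by simp
      qed
    qed
  qed
  finally show ?thesis .
qed

lemma nn_integral_resolvent_path:
  fixes f :: "'a \<Rightarrow> ennreal"
  assumes f: "f \<in> borel_measurable borel"
  shows "(\<integral>\<^sup>+z. f z \<partial>resolvent \<alpha>) =
    (\<integral>\<^sup>+u\<in>{0..}. ennreal (exp (- \<alpha> * u)) * (\<integral>\<^sup>+\<omega>. f (path u \<omega>) \<partial>M) \<partial>lborel)"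
  unfolding nn_integral_resolvent[OF f]
  by (intro nn_integral_cong) (auto simp: indicator_def nn_integral_path)

text \<open>The single-orbit identity is applied to the expectation of \<open>f\<close> along the
  path. The additive form avoids subtracting infinite values, and it includes
  \<open>\<alpha> = 0\<close>, the case of the potential measure.\<close>

lemma resolvent_equation:
  fixes f :: "'a \<Rightarrow> ennreal"
  assumes f[measurable]: "f \<in> borel_measurable borel" and ab: "\<alpha> < \<beta>" "0 < \<beta>"
  shows "(\<integral>\<^sup>+z. f z \<partial>resolvent \<alpha>) = (\<integral>\<^sup>+z. f z \<partial>resolvent \<beta>) +
    ennreal (\<beta> - \<alpha>) * (\<integral>\<^sup>+y. (\<integral>\<^sup>+z. f (y + z) \<partial>resolvent \<beta>) \<partial>resolvent \<alpha>)"
  unfolding nn_integral_resolvent_resolvent[OF f ab(2)] nn_integral_resolvent_path[OF f]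
  by (rule resolvent_equation_time[OF _ ab(1)]) measurable

lemma resolvent_commute:
  fixes f :: "'a \<Rightarrow> ennreal"
  assumes f[measurable]: "f \<in> borel_measurable borel" and ab: "0 < \<alpha>" "0 < \<beta>"
  shows "(\<integral>\<^sup>+y. (\<integral>\<^sup>+z. f (y + z) \<partial>resolvent \<beta>) \<partial>resolvent \<alpha>) =
    (\<integral>\<^sup>+y. (\<integral>\<^sup>+z. f (y + z) \<partial>resolvent \<alpha>) \<partial>resolvent \<beta>)"
  unfolding nn_integral_resolvent_resolvent[OF f ab(2)] nn_integral_resolvent_resolvent[OF f ab(1)]
  by (rule nn_integral_time_swap) measurable

text \<open>The resolvent operator for the process started at \<open>x\<close>; spatial homogeneity
  makes it the translate of a single measure.\<close>

abbreviation U :: "real \<Rightarrow> ('a \<Rightarrow> ennreal) \<Rightarrow> 'a \<Rightarrow> ennreal" where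
  "U \<alpha> f x \<equiv> (\<integral>\<^sup>+z. f (x + z) \<partial>resolvent \<alpha>)"

lemma U_equation:
  assumes f[measurable]: "f \<in> borel_measurable borel" and ab: "\<alpha> < \<beta>" "0 < \<beta>"
  shows "U \<alpha> f x = U \<beta> f x + ennreal (\<beta> - \<alpha>) * U \<alpha> (U \<beta> f) x"
  using resolvent_equation[of "\<lambda>z. f (x + z)", OF _ ab] by (simp add: add.assoc)

lemma U_commute:
  assumes f[measurable]: "f \<in> borel_measurable borel" and ab: "0 < \<alpha>" "0 < \<beta>"
  shows "U \<alpha> (U \<beta> f) x = U \<beta> (U \<alpha> f) x"
  using resolvent_commute[of "\<lambda>z. f (x + z)", OF _ ab] by (simp add: add.assoc)

text \<open>In the resolvent equation for the rates \<open>\<gamma>\<close> and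
  \<open>\<alpha> + \<gamma>\<close> the kernels commute and the first term is dropped. Potentials
  thereby qualify as dominating functions in the domination principle.\<close>

lemma supermedian_resolvent:
  assumes f[measurable]: "f \<in> borel_measurable borel" and "0 < \<alpha>" "0 < \<gamma>"
  shows "ennreal \<alpha> * U (\<alpha> + \<gamma>) (U \<gamma> f) x \<le> U \<gamma> f x"
  using U_equation[OF f, of \<gamma> "\<alpha> + \<gamma>" x] U_commute[OF f, of \<gamma> "\<alpha> + \<gamma>" x] assms by simp

lemma resolvent_antimono:
  assumes f: "f \<in> borel_measurable borel" and "\<alpha> \<le> \<gamma>"
  shows "(\<integral>\<^sup>+z. f z \<partial>resolvent \<gamma>) \<le> (\<integral>\<^sup>+z. f z \<partial>resolvent \<alpha>)"
  unfolding nn_integral_resolvent[OF f]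
  using assms(2) by (intro nn_integral_mono) (auto simp: indicator_def mult_right_mono intro!: mult_right_mono)

lemma resolvent_const:
  "\<gamma> > 0 \<Longrightarrow> (\<integral>\<^sup>+z. c \<partial>resolvent \<gamma>) = c * ennreal (1 / \<gamma>)"
  by (simp add: emeasure_resolvent_UNIV)

subsection \<open>The domination principle and local estimates\<close>

text \<open>The function \<open>f + \<alpha> U\<^sub>\<gamma> f\<close> is the potential of \<open>f\<close> for the sub-Markov kernel \<open>\<alpha> U\<^bsub>\<alpha> + \<gamma>\<^esub>\<close>,
  and for a chain in discrete time the principle is an induction on the number of steps.
  Letting \<open>\<alpha>\<close> tend to infinity recovers the statement about \<open>U\<^sub>\<gamma>\<close>, so the strong Markov property
  is not needed.\<close>

lemma domination_principle:
  fixes C :: real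
  assumes [measurable]: "f \<in> borel_measurable borel" "s \<in> borel_measurable borel"
    and l: "\<gamma> > 0" and C: "0 \<le> C" "\<And>x. f x \<le> ennreal C"
    and super: "\<And>\<alpha> x. 0 < \<alpha> \<Longrightarrow> ennreal \<alpha> * U (\<alpha> + \<gamma>) s x \<le> s x"
    and dom: "\<And>x. f x \<noteq> 0 \<Longrightarrow> U \<gamma> f x \<le> s x"
  shows "U \<gamma> f x \<le> s x"
proof -
  have step: "ennreal \<alpha> * U \<gamma> f x \<le> ennreal C + ennreal \<alpha> * s x" if a: "\<alpha> > 0" for \<alpha> x
  proof -
    \<comment> \<open>With P the kernel \<open>\<alpha> * U (\<alpha> + \<gamma>)\<close>, the
      function \<open>w\<close> solves \<open>w = f + P w\<close>; \<open>\<theta>\<close> is the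
      total mass of P and \<open>b\<close> an a priori bound for \<open>w\<close>.\<close>
    define w where "w x = f x + ennreal \<alpha> * U \<gamma> f x" for x
    define s' where "s' x = ennreal C + ennreal \<alpha> * s x" for x
    define \<theta> where "\<theta> = \<alpha> / (\<alpha> + \<gamma>)"
    define b where "b = C + \<alpha> * (C / \<gamma>)"
    have \<theta>: "0 \<le> \<theta>" "\<theta> < 1" and b: "0 \<le> b" using a l C by (auto simp: \<theta>_def b_def)
    have [measurable]: "w \<in> borel_measurable borel" "U \<gamma> f \<in> borel_measurable borel"
      using l unfolding w_def by measurable
    \<comment> \<open>Where \<open>f\<close> is nonzero the bound follows from the hypotheses.
      Elsewhere \<open>w = P w\<close>, and each application of P shrinks the error term by the
      factor \<open>\<theta>\<close>.\<close>
    have bound: "w x \<le> s' x + ennreal (b * \<theta> ^ n)" for n x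
    proof (induction n arbitrary: x)
      case 0
      have "U \<gamma> f x \<le> (\<integral>\<^sup>+z. ennreal C \<partial>resolvent \<gamma>)" by (intro nn_integral_mono C)
      also have "\<dots> = ennreal (C / \<gamma>)" using l C by (simp add: emeasure_resolvent_UNIV ennreal_mult[symmetric])
      finally have "w x \<le> ennreal C + ennreal \<alpha> * ennreal (C / \<gamma>)"
        unfolding w_def by (intro add_mono C mult_left_mono) auto
      also have "\<dots> = ennreal b" using a l C by (simp add: b_def ennreal_mult[symmetric])
      finally show ?case by (simp add: add_increasing)
    next
      case (Suc n)
      show ?case
      proof (cases "f x = 0")
        case False
        then have "w x \<le> s' x" unfolding w_def s'_def by (intro add_mono C mult_left_mono dom) auto
        then show ?thesis by (rule order_trans) simp
      next
        case True
        define K where "K = C + b * \<theta> ^ n"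
        have K: "0 \<le> K" using C b \<theta> by (simp add: K_def)
        have "w x = ennreal \<alpha> * U \<gamma> f x" by (simp add: w_def True)
        also have "\<dots> = ennreal \<alpha> * (U (\<alpha> + \<gamma>) f x + ennreal \<alpha> * U (\<alpha> + \<gamma>) (U \<gamma> f) x)"
          using U_equation[of f \<gamma> "\<alpha> + \<gamma>" x] U_commute[of f \<gamma> "\<alpha> + \<gamma>" x] a l by simp
        also have "U (\<alpha> + \<gamma>) f x + ennreal \<alpha> * U (\<alpha> + \<gamma>) (U \<gamma> f) x = U (\<alpha> + \<gamma>) w x"
          unfolding w_def by (subst nn_integral_add) (auto simp: nn_integral_cmult)
        also have "U (\<alpha> + \<gamma>) w x \<le> U (\<alpha> + \<gamma>) (\<lambda>y. ennreal K + ennreal \<alpha> * s y) x"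
        proof (rule nn_integral_mono)
          fix z
          show "w (x + z) \<le> ennreal K + ennreal \<alpha> * s (x + z)"
            using Suc.IH[of "x + z"] C b \<theta> by (simp add: K_def s'_def add_ac)
        qed
        also have "\<dots> = ennreal K * ennreal (1 / (\<alpha> + \<gamma>)) + ennreal \<alpha> * U (\<alpha> + \<gamma>) s x"
          using a l by (subst nn_integral_add) (auto simp: nn_integral_cmult emeasure_resolvent_UNIV)
        also have "ennreal \<alpha> * \<dots> = ennreal (K * \<theta>) + ennreal \<alpha> * (ennreal \<alpha> * U (\<alpha> + \<gamma>) s x)"
          using a l K by (simp add: distrib_left ennreal_mult[symmetric] \<theta>_def mult_ac)
        also have "\<dots> \<le> ennreal (C + b * \<theta> ^ Suc n) + ennreal \<alpha> * s x"
        proof (intro add_mono mult_left_mono super a ennreal_leI)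
          have "C * \<theta> \<le> C" using C \<theta> by (simp add: mult_left_le)
          then show "K * \<theta> \<le> C + b * \<theta> ^ Suc n" by (simp add: K_def algebra_simps)
        qed auto
        also have "\<dots> = s' x + ennreal (b * \<theta> ^ Suc n)"
          using C b \<theta> by (simp add: s'_def add_ac)
        finally show ?thesis by (simp add: mult_left_mono)
      qed
    qed
    have "(\<lambda>n. b * \<theta> ^ n) \<longlonglongrightarrow> b * 0"
      using \<theta> by (intro tendsto_mult tendsto_const LIMSEQ_power_zero) auto
    then have "(\<lambda>n. s' x + ennreal (b * \<theta> ^ n)) \<longlonglongrightarrow> s' x + ennreal (b * 0)"
      by (intro tendsto_add tendsto_const tendsto_ennrealI)
    then have "w x \<le> s' x + ennreal (b * 0)"
      by (rule LIMSEQ_le_const) (use bound in auto)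
    moreover have "ennreal \<alpha> * U \<gamma> f x \<le> w x" by (simp add: w_def add_increasing)
    ultimately show ?thesis by (simp add: s'_def)
  qed
  show ?thesis
  proof (rule ennreal_le_epsilon)
    fix e :: real assume e: "0 < e"
    \<comment> \<open>Dividing the bound by \<open>\<alpha>\<close> leaves the error
      \<open>C / \<alpha>\<close>, which is at most \<open>e\<close> for this choice; the added 1
      keeps \<open>\<alpha>\<close> positive when \<open>C = 0\<close>.\<close>
    define \<alpha> where "\<alpha> = (C + 1) / e"
    have a: "\<alpha> > 0" using e C by (simp add: \<alpha>_def)
    have "ennreal (1 / \<alpha>) * (ennreal \<alpha> * U \<gamma> f x) \<le> ennreal (1 / \<alpha>) * (ennreal C + ennreal \<alpha> * s x)"
      by (intro mult_left_mono step a) simp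
    also have "\<dots> = ennreal (C / \<alpha>) + s x"
      using a C by (simp add: distrib_left mult.assoc[symmetric] ennreal_mult[symmetric])
    also have "\<dots> \<le> ennreal e + s x"
      using e C by (intro add_mono ennreal_leI) (auto simp: \<alpha>_def field_simps)
    finally show "U \<gamma> f x \<le> s x + ennreal e"
      using a by (simp add: add.commute mult.assoc[symmetric] ennreal_mult[symmetric])
  qed
qed

text \<open>Before a short time \<open>d\<close>, stochastic continuity makes leaving the ball
  unlikely; after \<open>d\<close> the normalized discount weight is exponentially small in the
  rate.\<close>

lemma resolvent_outside_ball:
  fixes r e :: real
  assumes r: "r > 0" and e: "e > 0"
  obtains L where "L > 0" "\<And>\<gamma>. \<gamma> \<ge> L \<Longrightarrow> ennreal \<gamma> * emeasure (resolvent \<gamma>) (- ball 0 r) \<le> ennreal e"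
proof -
  \<comment> \<open>Half the radius is used because the complement of the open ball contains the
    sphere, whereas stochastic continuity speaks of a strict inequality.\<close>
  have "((\<lambda>u. prob {\<omega> \<in> space M. r / 2 < dist (X u \<omega>) (X 0 \<omega>)}) \<longlongrightarrow> 0) (at 0 within {0..})"
    using r by (intro stochastically_continuous) auto
  then have "\<forall>\<^sub>F u in at 0 within {0..}. prob {\<omega> \<in> space M. r / 2 < dist (X u \<omega>) (X 0 \<omega>)} < e / 2"
    using e by (intro order_tendstoD(2)) auto
  then obtain d where d: "d > 0"
    "\<And>u. 0 < u \<Longrightarrow> u < d \<Longrightarrow> prob {\<omega> \<in> space M. r / 2 < dist (X u \<omega>) (X 0 \<omega>)} < e / 2"
    unfolding eventually_at by (auto simp: dist_real_def)
  have p: "(\<integral>\<^sup>+\<omega>. indicator (- ball 0 r) (X u \<omega>) \<partial>M) \<le> ennreal (e / 2) + indicator {d..} u" if u: "0 \<le> u" for u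
  proof (cases "u < d")
    case False
    have "(\<integral>\<^sup>+\<omega>. indicator (- ball 0 r) (X u \<omega>) \<partial>M) \<le> (\<integral>\<^sup>+\<omega>. 1 \<partial>M)"
      by (intro nn_integral_mono) (auto simp: indicator_def)
    then show ?thesis using False by (simp add: emeasure_space_1 add_increasing)
  next
    case True
    have [measurable]: "X u \<in> borel_measurable M" "X 0 \<in> borel_measurable M"
      using u by (auto intro: random_variable_process)
    have "(\<integral>\<^sup>+\<omega>. indicator (- ball 0 r) (X u \<omega>) \<partial>M) \<le>
        (\<integral>\<^sup>+\<omega>. indicator {\<omega> \<in> space M. r / 2 < dist (X u \<omega>) (X 0 \<omega>)} \<omega> \<partial>M)"
      by (intro nn_integral_mono_AE, use start_0 AE_space in eventually_elim)
         (use r in \<open>auto simp: indicator_def\<close>)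
    also have "\<dots> = ennreal (prob {\<omega> \<in> space M. r / 2 < dist (X u \<omega>) (X 0 \<omega>)})"
      by (subst nn_integral_indicator) (auto simp: emeasure_eq_measure)
    also have "\<dots> \<le> ennreal (e / 2)"
      using d(2)[of u] True u r e by (cases "u = 0") (auto intro!: ennreal_leI)
    finally show ?thesis by (simp add: add_increasing2)
  qed
  show thesis
  \<comment> \<open>The constant comes from \<open>y \<le> exp y\<close> at
    \<open>y = l * d / 2\<close>: it makes \<open>2 * exp (- l * d / 2)\<close> at most
    \<open>e / 2\<close>.\<close>
  proof (rule that[of "8 / (e * d)"])
    show "0 < 8 / (e * d)" using e d by simp
    fix l :: real assume "8 / (e * d) \<le> l"
    moreover have "0 < 8 / (e * d)" using e d by simp
    ultimately have l: "l > 0" "8 / (e * d) \<le> l" by linarith+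
    have "emeasure (resolvent l) (- ball 0 r) = (\<integral>\<^sup>+z. indicator (- ball 0 r) z \<partial>resolvent l)"
      by simp
    also have "\<dots> = (\<integral>\<^sup>+u\<in>{0..}. ennreal (exp (- l * u)) * (\<integral>\<^sup>+\<omega>. indicator (- ball 0 r) (X u \<omega>) \<partial>M) \<partial>lborel)"
      by (intro nn_integral_resolvent) auto
    also have "\<dots> \<le> (\<integral>\<^sup>+u. ennreal (e / 2) * (ennreal (exp (- l * u)) * indicator {0..} u) +
        ennreal (exp (- l * d / 2)) * (ennreal (exp (- (l / 2) * u)) * indicator {0..} u) \<partial>lborel)"
    proof (intro nn_integral_mono)
      fix u :: real
      show "ennreal (exp (- l * u)) * (\<integral>\<^sup>+\<omega>. indicator (- ball 0 r) (X u \<omega>) \<partial>M) * indicator {0..} u \<le>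
        ennreal (e / 2) * (ennreal (exp (- l * u)) * indicator {0..} u) +
        ennreal (exp (- l * d / 2)) * (ennreal (exp (- (l / 2) * u)) * indicator {0..} u)"
      proof (cases "0 \<le> u")
        case True
        \<comment> \<open>Half of the exponent is spent on \<open>d \<le> u\<close>, and the other
          half remains for the integration in \<open>u\<close>.\<close>
        have "ennreal (exp (- l * u)) * indicator {d..} u \<le> ennreal (exp (- l * d / 2)) * ennreal (exp (- (l / 2) * u))"
        proof (cases "d \<le> u")
          case True
          have "l * d \<le> l * u" using True l by (intro mult_left_mono) auto
          then have "- l * u \<le> - l * d / 2 + - (l / 2) * u" by simp
          then have "exp (- l * u) \<le> exp (- l * d / 2) * exp (- (l / 2) * u)"
            by (simp add: exp_add[symmetric] del: minus_mult_left[symmetric])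
          then have "ennreal (exp (- l * u)) \<le> ennreal (exp (- l * d / 2) * exp (- (l / 2) * u))"
            by (rule ennreal_leI)
          then show ?thesis using True by (simp add: ennreal_mult)
        qed simp
        then have "ennreal (exp (- l * u)) * (ennreal (e / 2) + indicator {d..} u) \<le>
           ennreal (e / 2) * ennreal (exp (- l * u)) + ennreal (exp (- l * d / 2)) * ennreal (exp (- (l / 2) * u))"
          unfolding distrib_left by (intro add_mono) (auto simp: mult.commute)
        with mult_left_mono[OF p[OF True], of "ennreal (exp (- l * u))"] True show ?thesis
          by (auto intro: order_trans)
      qed simp
    qed
    also have "\<dots> = ennreal (e / 2) * ennreal (1 / l) + ennreal (exp (- l * d / 2)) * ennreal (1 / (l / 2))"
      using nn_integral_exp_atLeast[OF l(1)] nn_integral_exp_atLeast[of "l / 2"] l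
      by (subst nn_integral_add) (simp_all add: nn_integral_cmult)
    finally have "ennreal l * emeasure (resolvent l) (- ball 0 r) \<le> ennreal l * \<dots>"
      by (intro mult_left_mono) auto
    also have "\<dots> = ennreal (e / 2 + 2 * exp (- l * d / 2))"
      using l e by (simp add: ennreal_mult[symmetric] ennreal_plus[symmetric] field_simps del: ennreal_plus)
    also have "\<dots> \<le> ennreal e"
    proof (rule ennreal_leI)
      have "8 \<le> l * (e * d)" using l e d by (simp add: field_simps)
      then have "4 \<le> e * (l * d / 2)" by (simp add: mult_ac)
      also have "\<dots> \<le> e * exp (l * d / 2)"
      proof (rule mult_left_mono)
        show "l * d / 2 \<le> exp (l * d / 2)" using exp_ge_add_one_self[of "l * d / 2"] by linarith
      qed (use e in simp)
      finally show "e / 2 + 2 * exp (- l * d / 2) \<le> e" by (simp add: exp_minus field_simps)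
    qed
    finally show "ennreal l * emeasure (resolvent l) (- ball 0 r) \<le> ennreal e" .
  qed
qed

text \<open>The potential of a truncated function is at most \<open>n / \<gamma>\<close>, so its
  supremum is finite and can be absorbed; monotone convergence then removes the truncation.\<close>

lemma resolvent_le_by_truncation:
  assumes Q[measurable]: "Q \<in> borel_measurable borel" and l: "\<gamma> > 0"
    and le: "\<And>n x. U \<gamma> (\<lambda>y. min (Q y) (of_nat n)) x \<le> e + (SUP y. U \<gamma> (\<lambda>y. min (Q y) (of_nat n)) y) / 2"
  shows "U \<gamma> Q x \<le> 2 * e"
proof -
  have *: "U \<gamma> (\<lambda>y. min (Q y) (of_nat n)) x \<le> 2 * e" for n
  proof -
    let ?S = "SUP y. U \<gamma> (\<lambda>y. min (Q y) (of_nat n)) y"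
    have "?S \<le> of_nat n * ennreal (1 / \<gamma>)"
      unfolding resolvent_const[OF l, symmetric] by (intro SUP_least nn_integral_mono) simp
    also have "\<dots> < top" by (simp add: ennreal_mult_less_top of_nat_less_top)
    finally have "?S \<le> 2 * e" using le by (intro ennreal_le_double_of_half SUP_least)
    then show ?thesis by (rule order_trans[OF SUP_upper[OF UNIV_I]])
  qed
  have "Q y = (SUP n. min (Q y) (of_nat n))" for y
    unfolding inf_min[symmetric] inf_SUP[symmetric] by (simp add: ennreal_SUP_of_nat_eq_top)
  then have "U \<gamma> Q x = (\<integral>\<^sup>+z. (SUP n. min (Q (x + z)) (of_nat n)) \<partial>resolvent \<gamma>)"
    by simp
  also have "\<dots> = (SUP n. U \<gamma> (\<lambda>y. min (Q y) (of_nat n)) x)"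
    by (intro nn_integral_monotone_convergence_SUP)
       (auto simp: incseq_def le_fun_def intro: min.coboundedI2)
  also have "\<dots> \<le> 2 * e" by (intro SUP_least *)
  finally show ?thesis .
qed

text \<open>The part of the potential produced outside the ball is compared with a multiple of
  \<open>\<gamma> U\<^sub>\<gamma> 1\<close> of the complement of the half ball, which is at least \<open>1/2\<close> outside the ball and at
  most \<open>1/4\<close> at the centre.\<close>

lemma resolvent_le_of_local:
  assumes Q[measurable]: "Q \<in> borel_measurable borel" and l: "\<gamma> > 0"
    and small: "ennreal \<gamma> * emeasure (resolvent \<gamma>) (- ball 0 (r / 2)) \<le> ennreal (1 / 4)"
    and loc: "\<And>x. (\<integral>\<^sup>+z\<in>ball 0 r. Q (x + z) \<partial>resolvent \<gamma>) \<le> e"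
  shows "U \<gamma> Q x \<le> 2 * e"
proof (rule resolvent_le_by_truncation[OF Q l])
  fix n x0
  define T where "T y = min (Q y) (of_nat n)" for y
  have [measurable]: "T \<in> borel_measurable borel" unfolding T_def by measurable
  define S where "S = (SUP y. U \<gamma> T y)"
  define f where "f y = T y * indicator (- ball x0 r) y" for y
  define h where "h = (indicator (- ball x0 (r / 2)) :: 'a \<Rightarrow> ennreal)"
  define s where "s y = 2 * S * (ennreal \<gamma> * U \<gamma> h y)" for y
  have [measurable]: "f \<in> borel_measurable borel" "h \<in> borel_measurable borel" 
    unfolding f_def h_def by measurable
  have Uh[measurable]: "U \<gamma> h \<in> borel_measurable borel" using l by measurable
  have [measurable]: "s \<in> borel_measurable borel" unfolding s_def by measurable
  have "U \<gamma> f x0 \<le> s x0"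
  proof (rule domination_principle[where C = "real n"])
    show "f y \<le> ennreal (real n)" for y
      by (auto simp: f_def T_def indicator_def ennreal_of_nat_eq_real_of_nat)
  next
    fix a :: real and y assume a: "0 < a"
    have "ennreal a * U (a + \<gamma>) s y = 2 * S * ennreal \<gamma> * (ennreal a * U (a + \<gamma>) (U \<gamma> h) y)"
      unfolding s_def by (simp add: nn_integral_cmult mult_ac)
    also have "\<dots> \<le> 2 * S * ennreal \<gamma> * U \<gamma> h y"
      using a l by (intro mult_left_mono supermedian_resolvent) auto
    finally show "ennreal a * U (a + \<gamma>) s y \<le> s y" by (simp add: s_def mult_ac)
  next
    fix y assume "f y \<noteq> 0"
    then have y: "r \<le> dist x0 y" by (auto simp: f_def indicator_def split: if_splits)
    have "emeasure (resolvent \<gamma>) (ball 0 (r / 2)) = (\<integral>\<^sup>+z. indicator (ball 0 (r / 2)) z \<partial>resolvent \<gamma>)"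
      by simp
    also have "\<dots> \<le> U \<gamma> h y"
    proof (intro nn_integral_mono)
      fix z
      \<comment> \<open>As \<open>y\<close> is at distance at least \<open>r\<close> from
        \<open>x0\<close>, a step shorter than \<open>r / 2\<close> cannot reach the half ball
        around \<open>x0\<close>.\<close>
      have "norm z \<ge> r / 2" if "dist x0 (y + z) < r / 2"
        using that y norm_triangle_ineq4[of "x0 - (y + z)" "- z"] by (simp add: dist_norm)
      then show "indicator (ball 0 (r / 2)) z \<le> h (y + z)" by (auto simp: h_def indicator_def)
    qed
    finally have 1: "ennreal \<gamma> * emeasure (resolvent \<gamma>) (ball 0 (r / 2)) \<le> ennreal \<gamma> * U \<gamma> h y"
      by (intro mult_left_mono) auto
    \<comment> \<open>The total mass of \<open>\<gamma>\<close> times the resolvent measure is 1, so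
      the half ball carries at least 3/4 of it. The sum form avoids subtraction.\<close>
    have "emeasure (resolvent \<gamma>) (ball 0 (r / 2)) + emeasure (resolvent \<gamma>) (- ball 0 (r / 2)) = ennreal (1 / \<gamma>)"
      by (subst plus_emeasure) (auto simp: emeasure_resolvent_UNIV[OF l])
    then have "1 = ennreal \<gamma> * (emeasure (resolvent \<gamma>) (ball 0 (r / 2)) + emeasure (resolvent \<gamma>) (- ball 0 (r / 2)))"
      using l by (simp add: ennreal_mult[symmetric])
    also have "\<dots> \<le> ennreal \<gamma> * U \<gamma> h y + ennreal (1 / 4)"
      unfolding distrib_left by (intro add_mono 1 small)
    finally have "1 \<le> ennreal \<gamma> * U \<gamma> h y + ennreal (1 / 4)" .
    then have "1 \<le> 2 * (ennreal \<gamma> * U \<gamma> h y)"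
    proof (cases "ennreal \<gamma> * U \<gamma> h y")
      case (real v)
      assume "1 \<le> ennreal \<gamma> * U \<gamma> h y + ennreal (1 / 4)"
      then have "ennreal 1 \<le> ennreal (v + 1 / 4)" using real by simp
      then have "1 \<le> v + 1 / 4" using real by (subst (asm) ennreal_le_iff) auto
      then have "ennreal 1 \<le> ennreal (2 * v)" by (intro ennreal_leI) auto
      then show ?thesis using real by (simp add: ennreal_mult)
    qed (simp add: ennreal_mult_top)
    then have "S \<le> S * (2 * (ennreal \<gamma> * U \<gamma> h y))"
      using mult_left_mono[of 1 _ S] by simp
    moreover have "U \<gamma> f y \<le> S"
      unfolding S_def f_def by (rule SUP_upper2[of y]) (auto intro!: nn_integral_mono simp: indicator_def)
    ultimately show "U \<gamma> f y \<le> s y" by (simp add: s_def mult_ac)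
  qed (use l in auto)
  also have "U \<gamma> h x0 = (\<integral>\<^sup>+z. indicator (- ball 0 (r / 2)) z \<partial>resolvent \<gamma>)"
    by (intro nn_integral_cong) (auto simp: h_def indicator_def dist_norm)
  then have "s x0 \<le> 2 * S * ennreal (1 / 4)"
    unfolding s_def using small by (intro mult_left_mono) auto
  also have "\<dots> = S / 2"
  proof -
    have "2 * ennreal (1 / 4) = ennreal (1 / 2)"
      by (simp add: ennreal_mult[symmetric] ennreal_numeral[symmetric] del: ennreal_numeral)
    then have "S * (2 * ennreal (1 / 4)) = S / 2"
      by (simp add: divide_ennreal_def)
    then show ?thesis by (simp add: mult_ac)
  qed
  finally have 2: "U \<gamma> f x0 \<le> S / 2" .
  have [measurable]: "ball (0 :: 'a) r \<in> sets borel" by simp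
  have "U \<gamma> T x0 = (\<integral>\<^sup>+z. T (x0 + z) * indicator (ball 0 r) z + f (x0 + z) \<partial>resolvent \<gamma>)"
    by (intro nn_integral_cong) (auto simp: f_def indicator_def dist_norm)
  also have "\<dots> = (\<integral>\<^sup>+z\<in>ball 0 r. T (x0 + z) \<partial>resolvent \<gamma>) + U \<gamma> f x0"
    by (rule nn_integral_add) measurable
  also have "\<dots> \<le> e + S / 2"
  proof (intro add_mono 2 order_trans[OF _ loc[of x0]] nn_integral_mono mult_right_mono)
  qed (auto simp: T_def)
  finally show "U \<gamma> (\<lambda>y. min (Q y) (of_nat n)) x0 \<le> e + (SUP y. U \<gamma> (\<lambda>y. min (Q y) (of_nat n)) y) / 2"
    by (simp add: S_def T_def)
qed

section \<open>Resolvents compared with integrals over a short time\<close>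

text \<open>On \<open>{0..t}\<close> the factor \<open>exp (\<gamma> * (t - u))\<close> is at least
  1, so inserting it and then extending the time range only increases the integral.\<close>

lemma time_le_resolvent:
  assumes [measurable]: "Q \<in> borel_measurable borel" and l: "\<gamma> \<ge> 0"
  shows "(\<integral>\<^sup>+u\<in>{0..t}. (\<integral>\<^sup>+\<omega>. Q (x + X u \<omega>) \<partial>M) \<partial>lborel) \<le> ennreal (exp (\<gamma> * t)) * U \<gamma> Q x"
proof -
  have "(\<integral>\<^sup>+u\<in>{0..t}. (\<integral>\<^sup>+\<omega>. Q (x + X u \<omega>) \<partial>M) \<partial>lborel) =
    (\<integral>\<^sup>+u\<in>{0..t}. (\<integral>\<^sup>+\<omega>. Q (x + path u \<omega>) \<partial>M) \<partial>lborel)"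
    by (intro nn_integral_cong) (auto simp: indicator_def nn_integral_path[where f="\<lambda>y. Q (x + y)"])
  also have "\<dots> \<le> (\<integral>\<^sup>+u. ennreal (exp (\<gamma> * t)) * (ennreal (exp (- \<gamma> * u)) * (\<integral>\<^sup>+\<omega>. Q (x + path u \<omega>) \<partial>M) * indicator {0..} u) \<partial>lborel)"
  proof (intro nn_integral_mono)
    fix u :: real
    have "1 \<le> ennreal (exp (\<gamma> * t)) * ennreal (exp (- \<gamma> * u))" if "0 \<le> u" "u \<le> t"
    proof -
      have "1 \<le> exp (\<gamma> * t + (- \<gamma> * u))" using that l by (simp add: mult_left_mono)
      then have "ennreal 1 \<le> ennreal (exp (\<gamma> * t + (- \<gamma> * u)))" by (rule ennreal_leI)
      then show ?thesis by (simp only: exp_add ennreal_mult exp_ge_zero ennreal_1)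
    qed
    then show "(\<integral>\<^sup>+\<omega>. Q (x + path u \<omega>) \<partial>M) * indicator {0..t} u \<le>
      ennreal (exp (\<gamma> * t)) * (ennreal (exp (- \<gamma> * u)) * (\<integral>\<^sup>+\<omega>. Q (x + path u \<omega>) \<partial>M) * indicator {0..} u)"
      using mult_right_mono[of 1 "ennreal (exp (\<gamma> * t)) * ennreal (exp (- \<gamma> * u))" "\<integral>\<^sup>+\<omega>. Q (x + path u \<omega>) \<partial>M"]
      by (auto simp: indicator_def mult_ac)
  qed
  also have "\<dots> = ennreal (exp (\<gamma> * t)) * U \<gamma> Q x"
    by (simp add: nn_integral_cmult nn_integral_resolvent_path[of "\<lambda>z. Q (x + z)"])
  finally show ?thesis .
qed

text \<open>The time axis is cut at \<open>t\<close>. By the Markov property the part after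
  \<open>t\<close> is \<open>exp (- \<gamma> * t)\<close> times an expectation of the resolvent
  potential, hence at most half its supremum, which is absorbed.\<close>

lemma resolvent_le_of_time:
  assumes Q[measurable]: "Q \<in> borel_measurable borel" and l: "\<gamma> > 0" and t: "t > 0" and lt: "exp (- \<gamma> * t) \<le> 1 / 2"
    and time: "\<And>x. (\<integral>\<^sup>+u\<in>{0..t}. (\<integral>\<^sup>+\<omega>. Q (x + X u \<omega>) \<partial>M) \<partial>lborel) \<le> e"
  shows "U \<gamma> Q x \<le> 2 * e"
proof (rule resolvent_le_by_truncation[OF Q l])
  fix n x
  define T where "T y = min (Q y) (of_nat n)" for y
  have [measurable]: "T \<in> borel_measurable borel" unfolding T_def by measurable
  define S where "S = (SUP y. U \<gamma> T y)"
  define p where "p u = (\<integral>\<^sup>+\<omega>. T (x + path u \<omega>) \<partial>M)" for u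
  have p[measurable]: "p \<in> borel_measurable borel" unfolding p_def by measurable
  have pX: "p u = (\<integral>\<^sup>+\<omega>. T (x + X u \<omega>) \<partial>M)" if "0 \<le> u" for u
    unfolding p_def using that by (rule nn_integral_path[where f="\<lambda>y. T (x + y)"])
  have "U \<gamma> T x = (\<integral>\<^sup>+u\<in>{0..}. ennreal (exp (- \<gamma> * u)) * p u \<partial>lborel)"
    unfolding p_def by (rule nn_integral_resolvent_path) measurable
  also have "\<dots> \<le> (\<integral>\<^sup>+u. p u * indicator {0..t} u + ennreal (exp (- \<gamma> * u)) * p u * indicator {t..} u \<partial>lborel)"
  proof (intro nn_integral_mono)
    fix u :: real
    have "ennreal (exp (- \<gamma> * u)) * p u \<le> 1 * p u" if "0 \<le> u"
      using that l by (intro mult_right_mono) auto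
    then show "ennreal (exp (- \<gamma> * u)) * p u * indicator {0..} u \<le>
      p u * indicator {0..t} u + ennreal (exp (- \<gamma> * u)) * p u * indicator {t..} u"
      by (auto simp: indicator_def add_increasing add_increasing2)
  qed
  also have "\<dots> = (\<integral>\<^sup>+u\<in>{0..t}. p u \<partial>lborel) + (\<integral>\<^sup>+u\<in>{t..}. ennreal (exp (- \<gamma> * u)) * p u \<partial>lborel)"
    by (rule nn_integral_add) measurable
  also have "\<dots> \<le> e + S / 2"
  proof (rule add_mono)
    have "(\<integral>\<^sup>+u\<in>{0..t}. p u \<partial>lborel) \<le> (\<integral>\<^sup>+u\<in>{0..t}. (\<integral>\<^sup>+\<omega>. Q (x + X u \<omega>) \<partial>M) \<partial>lborel)"
      by (intro nn_integral_mono) (auto simp: indicator_def pX T_def intro!: nn_integral_mono)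
    also have "\<dots> \<le> e" by (rule time)
    finally show "(\<integral>\<^sup>+u\<in>{0..t}. p u \<partial>lborel) \<le> e" .
  next
    have "(\<integral>\<^sup>+u\<in>{t..}. ennreal (exp (- \<gamma> * u)) * p u \<partial>lborel) =
      (\<integral>\<^sup>+v. ennreal (exp (- \<gamma> * (t + v))) * p (t + v) * indicator {t..} (t + v) \<partial>lborel)"
      by (subst nn_integral_real_affine[where c=1 and t=t]) auto
    also have "\<dots> = (\<integral>\<^sup>+v. ennreal (exp (- \<gamma> * t)) * (ennreal (exp (- \<gamma> * v)) * p (t + v) * indicator {0..} v) \<partial>lborel)"
    proof (rule nn_integral_cong)
      fix v :: real
      have "ennreal (exp (- \<gamma> * (t + v))) = ennreal (exp (- \<gamma> * t)) * ennreal (exp (- \<gamma> * v))"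
        by (simp only: distrib_left exp_add ennreal_mult exp_ge_zero)
      then show "ennreal (exp (- \<gamma> * (t + v))) * p (t + v) * indicator {t..} (t + v) =
          ennreal (exp (- \<gamma> * t)) * (ennreal (exp (- \<gamma> * v)) * p (t + v) * indicator {0..} v)"
        by (simp only: mult.assoc) (simp add: indicator_def)
    qed
    also have "\<dots> = ennreal (exp (- \<gamma> * t)) * (\<integral>\<^sup>+v\<in>{0..}. ennreal (exp (- \<gamma> * v)) * p (t + v) \<partial>lborel)"
      by (rule nn_integral_cmult) measurable
    also have "(\<integral>\<^sup>+v\<in>{0..}. ennreal (exp (- \<gamma> * v)) * p (t + v) \<partial>lborel) =
       (\<integral>\<^sup>+\<omega>. (\<integral>\<^sup>+z. T (x + (X t \<omega> + z)) \<partial>resolvent \<gamma>) \<partial>M)"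
      using t by (subst nn_integral_shift_time[of "\<lambda>z. T (x + z)"])
        (auto intro!: nn_integral_cong simp: indicator_def pX)
    also have "\<dots> \<le> (\<integral>\<^sup>+\<omega>. S \<partial>M)"
    proof (intro nn_integral_mono)
      fix \<omega>
      have "U \<gamma> T (x + X t \<omega>) \<le> S" unfolding S_def by (rule SUP_upper) simp
      then show "(\<integral>\<^sup>+z. T (x + (X t \<omega> + z)) \<partial>resolvent \<gamma>) \<le> S" by (simp add: add.assoc)
    qed
    also have "\<dots> = S" by (simp add: emeasure_space_1)
    also have "ennreal (exp (- \<gamma> * t)) * S \<le> ennreal (1 / 2) * S"
      by (intro mult_right_mono ennreal_leI lt) simp
    also have "\<dots> = S / 2"
      by (simp add: divide_ennreal_def mult.commute)
    finally show "(\<integral>\<^sup>+u\<in>{t..}. ennreal (exp (- \<gamma> * u)) * p u \<partial>lborel) \<le> S / 2"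
      by (simp add: mult_left_mono)
  qed
  finally show "U \<gamma> (\<lambda>y. min (Q y) (of_nat n)) x \<le> e + (SUP y. U \<gamma> (\<lambda>y. min (Q y) (of_nat n)) y) / 2"
    by (simp add: S_def T_def)
qed

end

section \<open>Lebesgue measure: translation, doubling, and domination of other measures\<close>

lemma nn_integral_lborel_translate:
  fixes f :: "'b::euclidean_space \<Rightarrow> ennreal"
  assumes [measurable]: "f \<in> borel_measurable borel"
  shows "(\<integral>\<^sup>+x. f (c + x) \<partial>lborel) = (\<integral>\<^sup>+x. f x \<partial>lborel)"
proof -
  have "(\<integral>\<^sup>+x. f x \<partial>lborel) = (\<integral>\<^sup>+x. f x \<partial>distr lborel borel ((+) c))"
    by (simp add: lborel_distr_plus)
  also have "\<dots> = (\<integral>\<^sup>+x. f (c + x) \<partial>lborel)"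
    by (rule nn_integral_distr) auto
  finally show ?thesis ..
qed

lemma emeasure_ball_double:
  "emeasure lborel (ball (c :: 'b::euclidean_space) (2 * r)) = 2 ^ DIM('b) * emeasure lborel (ball (0 :: 'b) r)"
proof (cases "0 \<le> r")
  case True
  then have "emeasure lborel (ball c (2 * r)) = ennreal (2 ^ DIM('b)) * ennreal (unit_ball_vol (DIM('b)) * r ^ DIM('b))"
    by (simp add: emeasure_ball ennreal_mult[symmetric] power_mult_distrib mult_ac)
  with True show ?thesis by (simp add: emeasure_ball ennreal_power[symmetric] del: ennreal_power)
next
  case False
  then have "ball c (2 * r) = {}" "ball (0 :: 'b) r = {}" by auto
  then show ?thesis by (simp only: emeasure_empty mult_zero_right)
qed

text \<open>Outer regularity of Lebesgue measure carries the bound from open sets to Borel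
  sets.\<close>

lemma emeasure_le_of_open:
  fixes N :: "'b::euclidean_space measure"
  assumes N: "sets N = sets borel"
    and le: "\<And>S. open S \<Longrightarrow> emeasure N S \<le> ennreal C * emeasure lborel S" and C: "0 \<le> C"
    and A: "A \<in> sets borel"
  shows "emeasure N A \<le> ennreal C * emeasure lborel A"
proof (rule ennreal_le_epsilon)
  fix e :: real assume e: "0 < e"
  \<comment> \<open>With this tolerance the error \<open>C * (e / (C + 1))\<close> is at most
    \<open>e\<close>, also when \<open>C = 0\<close>.\<close>
  then obtain S where S: "open S" "A \<subseteq> S" "emeasure lborel (S - A) < ennreal (e / (C + 1))"
    using outer_regular_lborel[OF A, of "e / (C + 1)"] C by auto
  have "emeasure N A \<le> emeasure N S" using S N by (intro emeasure_mono) auto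
  also have "\<dots> \<le> ennreal C * emeasure lborel S" by (rule le) fact
  also have "emeasure lborel S = emeasure lborel A + emeasure lborel (S - A)"
    using S A by (subst plus_emeasure) (auto simp: Un_absorb1)
  also have "ennreal C * \<dots> \<le> ennreal C * (emeasure lborel A + ennreal (e / (C + 1)))"
    using S(3) by (intro mult_left_mono add_mono) auto
  also have "\<dots> = ennreal C * emeasure lborel A + ennreal (C * (e / (C + 1)))"
    using C e by (simp add: distrib_left ennreal_mult[symmetric])
  also have "\<dots> \<le> ennreal C * emeasure lborel A + ennreal e"
    using C e by (intro add_mono ennreal_leI) (auto simp: field_simps)
  finally show "emeasure N A \<le> ennreal C * emeasure lborel A + ennreal e" .
qed

text \<open>On the set where \<open>g\<close> exceeds \<open>C + 1\<close> the measure would be both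
  at least \<open>C + 1\<close> and at most \<open>C\<close> times Lebesgue measure, which forces
  that set to be null.\<close>

lemma density_bounded:
  fixes g :: "'b::euclidean_space \<Rightarrow> ennreal"
  assumes g[measurable]: "g \<in> borel_measurable borel" and C: "0 \<le> C"
    and le: "\<And>A. A \<in> sets borel \<Longrightarrow> emeasure (density lborel g) A \<le> ennreal C * emeasure lborel A"
  shows "AE z in lborel. g z \<le> ennreal (C + 1)"
proof -
  \<comment> \<open>Intersecting with balls makes the Lebesgue measure finite, so that it can be
    compared as a real number.\<close>
  define A where "A n = {z. \<not> g z \<le> ennreal (C + 1)} \<inter> ball 0 (real n)" for n
  have A[measurable]: "A n \<in> sets borel" for n
  proof -
    have "{z. \<not> g z \<le> ennreal (C + 1)} \<in> sets borel" by measurable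
    then show ?thesis unfolding A_def by auto
  qed
  have null: "emeasure lborel (A n) = 0" for n
  proof -
    have fin: "emeasure lborel (A n) < \<infinity>"
      by (rule le_less_trans[OF emeasure_mono emeasure_lborel_ball_finite[of 0 "real n"]]) (auto simp: A_def)
    have "ennreal (C + 1) * emeasure lborel (A n) = (\<integral>\<^sup>+z. ennreal (C + 1) * indicator (A n) z \<partial>lborel)"
      by (simp add: nn_integral_cmult)
    also have "\<dots> \<le> (\<integral>\<^sup>+z. g z * indicator (A n) z \<partial>lborel)"
      by (intro nn_integral_mono) (auto simp: A_def indicator_def)
    also have "\<dots> = emeasure (density lborel g) (A n)" by (simp add: emeasure_density)
    also have "\<dots> \<le> ennreal C * emeasure lborel (A n)" by (rule le) simp
    finally have *: "ennreal (C + 1) * emeasure lborel (A n) \<le> ennreal C * emeasure lborel (A n)" .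
    obtain v where v: "emeasure lborel (A n) = ennreal v" "0 \<le> v"
      using fin by (cases "emeasure lborel (A n)") auto
    have "(C + 1) * v \<le> C * v"
      using * v C by (simp add: ennreal_mult[symmetric] del: ennreal_plus)
    with v show ?thesis by (simp add: algebra_simps)
  qed
  have "AE z in lborel. \<forall>n. z \<notin> A n"
    unfolding AE_all_countable using null by (intro allI AE_not_in) (auto simp: null_sets_def)
  then show ?thesis
  proof eventually_elim
    case (elim z)
    obtain n where "norm z < real n" using reals_Archimedean2 by blast
    with elim show ?case by (auto simp: A_def dest: spec[of _ n])
  qed
qed

context levy_process
begin

section \<open>Resolvent mass of balls and Lebesgue integrals\<close>

text \<open>Translates of \<open>f\<close> all have the same Lebesgue integral, so averaging them
  only contributes the total mass \<open>1 / \<gamma>\<close>.\<close>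

lemma lborel_integral_U:
  assumes [measurable]: "f \<in> borel_measurable borel" and l: "\<gamma> > 0"
  shows "(\<integral>\<^sup>+x. U \<gamma> f x \<partial>lborel) = ennreal (1 / \<gamma>) * (\<integral>\<^sup>+x. f x \<partial>lborel)"
proof -
  interpret R: finite_measure "resolvent \<gamma>" by (rule finite_measure_resolvent) fact
  interpret pair_sigma_finite "resolvent \<gamma>" lborel ..
  have "(\<integral>\<^sup>+x. U \<gamma> f x \<partial>lborel) = (\<integral>\<^sup>+z. \<integral>\<^sup>+x. f (x + z) \<partial>lborel \<partial>resolvent \<gamma>)"
    by (rule Fubini'[of "\<lambda>z x. f (x + z)"]) measurable
  also have "\<dots> = (\<integral>\<^sup>+z. \<integral>\<^sup>+x. f x \<partial>lborel \<partial>resolvent \<gamma>)"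
    by (simp add: add.commute[of _ "_ :: 'a"] nn_integral_lborel_translate)
  also have "\<dots> = ennreal (1 / \<gamma>) * (\<integral>\<^sup>+x. f x \<partial>lborel)"
    by (simp add: emeasure_resolvent_UNIV[OF l] mult.commute)
  finally show ?thesis .
qed

text \<open>Seen from one of its own points, a ball of radius \<open>r\<close> lies in the centred
  ball of radius \<open>2 * r\<close>. This bounds the potential of its indicator on the ball
  itself, and domination by a constant extends the bound to the origin.\<close>

lemma resolvent_ball_le:
  assumes l: "\<gamma> > 0"
  shows "emeasure (resolvent \<gamma>) (ball x r) \<le> emeasure (resolvent \<gamma>) (ball 0 (2 * r))"
proof -
  let ?f = "indicator (ball x r) :: 'a \<Rightarrow> ennreal" and ?c = "emeasure (resolvent \<gamma>) (ball 0 (2 * r))"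
  have "U \<gamma> ?f 0 \<le> ?c"
  proof (rule domination_principle[where C = 1 and s = "\<lambda>_. ?c"])
    fix a :: real and y :: 'a assume a: "0 < a"
    have "ennreal a * (\<integral>\<^sup>+z. ?c \<partial>resolvent (a + \<gamma>)) = ?c * (ennreal a * ennreal (1 / (a + \<gamma>)))"
      using a l by (simp add: emeasure_resolvent_UNIV mult.left_commute)
    also have "\<dots> = ?c * ennreal (a / (a + \<gamma>))"
      using a l by (simp add: ennreal_mult[symmetric])
    also have "\<dots> \<le> ?c * 1"
      using a l by (intro mult_left_mono) auto
    finally show "ennreal a * (\<integral>\<^sup>+z. ?c \<partial>resolvent (a + \<gamma>)) \<le> ?c" by simp
  next
    fix y assume "?f y \<noteq> 0"
    then have y: "dist x y < r" by (auto simp: indicator_def split: if_splits)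
    have "U \<gamma> ?f y \<le> (\<integral>\<^sup>+z. indicator (ball 0 (2 * r)) z \<partial>resolvent \<gamma>)"
    proof (rule nn_integral_mono)
      fix z
      have "norm z < 2 * r" if "dist x (y + z) < r"
        using that y norm_triangle_ineq4[of "x - y" "x - (y + z)"] by (simp add: dist_norm)
      then show "?f (y + z) \<le> indicator (ball 0 (2 * r)) z" by (auto simp: indicator_def)
    qed
    then show "U \<gamma> ?f y \<le> ?c" by simp
  qed (use l in \<open>auto simp: indicator_def\<close>)
  then show ?thesis by simp
qed

text \<open>Fatou's lemma applied to the averages of the indicator of \<open>S\<close> over small balls.\<close>

lemma resolvent_open_le:
  assumes l: "\<gamma> > 0" and r0: "r \<longlonglongrightarrow> 0" and r: "\<And>n. 0 < r n"
    and le: "\<And>n. emeasure (resolvent \<gamma>) (ball 0 (2 * r n)) \<le> ennreal K * emeasure lborel (ball (0::'a) (r n))"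
    and S: "open S"
  shows "emeasure (resolvent \<gamma>) S \<le> ennreal K * emeasure lborel S"
proof -
  interpret R: finite_measure "resolvent \<gamma>" by (rule finite_measure_resolvent) fact
  interpret pair_sigma_finite "resolvent \<gamma>" lborel ..
  have [measurable]: "S \<in> sets borel" using S by simp
  define v where "v n = emeasure lborel (ball (0::'a) (r n))" for n
  have v: "0 < v n" "v n < top" for n
    using r[of n] by (auto simp: v_def emeasure_ball)
  have inv: "inverse (v n) * v n = 1" for n
    using v[of n] by (simp add: ennreal_inverse_mult mult.commute ennreal_mult_divide_eq divide_ennreal_def[symmetric])
  \<comment> \<open>\<open>u n z\<close> is the fraction of \<open>ball z (r n)\<close> covered by
    \<open>S\<close>; the indicator of a set of pairs makes the integrand jointly measurable for
    Fubini.\<close>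
  define u where "u n z = inverse (v n) * (\<integral>\<^sup>+y. indicator S y * indicator {p. dist (fst p) (snd p) < r n} (z, y) \<partial>lborel)" for n and z :: 'a
  have [measurable]: "Measurable.pred (borel \<Otimes>\<^sub>M borel) (\<lambda>p::'a \<times> 'a. dist (fst p) (snd p) < r n)" for n
    by measurable
  have m[measurable]: "{p :: 'a \<times> 'a. dist (fst p) (snd p) < r n} \<in> sets (borel \<Otimes>\<^sub>M borel)" for n
  proof -
    have "open {p :: 'a \<times> 'a. dist (fst p) (snd p) < r n}" by (intro open_Collect_less continuous_intros)
    then show ?thesis unfolding borel_prod by (rule borel_open)
  qed
  have [measurable]: "u n \<in> borel_measurable borel" for n unfolding u_def by measurable
  have "emeasure (resolvent \<gamma>) S = (\<integral>\<^sup>+z. indicator S z \<partial>resolvent \<gamma>)" by simp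
  also have "\<dots> \<le> (\<integral>\<^sup>+z. liminf (\<lambda>n. u n z) \<partial>resolvent \<gamma>)"
  proof (rule nn_integral_mono)
    fix z
    show "indicator S z \<le> liminf (\<lambda>n. u n z)"
    proof (cases "z \<in> S")
      case True
      then obtain d where d: "d > 0" "ball z d \<subseteq> S" using S open_contains_ball by blast
      have "\<forall>\<^sub>F n in sequentially. r n < d" using r0 d(1) by (rule order_tendstoD)
      then have "\<forall>\<^sub>F n in sequentially. 1 \<le> u n z"
      proof eventually_elim
        case (elim n)
        have "v n = emeasure lborel (ball z (r n))" using r[of n] by (simp add: v_def emeasure_ball)
        also have "\<dots> = (\<integral>\<^sup>+y. indicator (ball z (r n)) y \<partial>lborel)" by simp
        also have "\<dots> \<le> (\<integral>\<^sup>+y. indicator S y * indicator {p. dist (fst p) (snd p) < r n} (z, y) \<partial>lborel)"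
          using order_trans[OF subset_ball[OF less_imp_le[OF elim]] d(2)]
          by (intro nn_integral_mono) (auto simp: indicator_def)
        finally have "inverse (v n) * v n \<le> u n z" unfolding u_def by (intro mult_left_mono) auto
        then show ?case by (simp add: inv)
      qed
      then have "1 \<le> liminf (\<lambda>n. u n z)" by (rule Liminf_bounded)
      then show ?thesis using True by simp
    qed simp
  qed
  also have "\<dots> \<le> liminf (\<lambda>n. \<integral>\<^sup>+z. u n z \<partial>resolvent \<gamma>)" by (rule nn_integral_liminf) measurable
  also have "\<dots> \<le> ennreal K * emeasure lborel S"
  proof -
    have "(\<integral>\<^sup>+z. u n z \<partial>resolvent \<gamma>) \<le> ennreal K * emeasure lborel S" for n
    proof -
      have "(\<integral>\<^sup>+z. u n z \<partial>resolvent \<gamma>) = inverse (v n) *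
          (\<integral>\<^sup>+z. (\<integral>\<^sup>+y. indicator S y * indicator {p. dist (fst p) (snd p) < r n} (z, y) \<partial>lborel) \<partial>resolvent \<gamma>)"
        unfolding u_def by (rule nn_integral_cmult) measurable
      also have "(\<integral>\<^sup>+z. (\<integral>\<^sup>+y. indicator S y * indicator {p. dist (fst p) (snd p) < r n} (z, y) \<partial>lborel) \<partial>resolvent \<gamma>) =
        (\<integral>\<^sup>+y. (\<integral>\<^sup>+z. indicator S y * indicator {p. dist (fst p) (snd p) < r n} (z, y) \<partial>resolvent \<gamma>) \<partial>lborel)"
        by (rule Fubini'[symmetric]) measurable
      also have "\<dots> = (\<integral>\<^sup>+y. indicator S y * emeasure (resolvent \<gamma>) (ball y (r n)) \<partial>lborel)"
      proof (rule nn_integral_cong)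
        fix y :: 'a
        have "(\<integral>\<^sup>+z. indicator S y * indicator {p. dist (fst p) (snd p) < r n} (z, y) \<partial>resolvent \<gamma>) =
          (\<integral>\<^sup>+z. indicator S y * indicator (ball y (r n)) z \<partial>resolvent \<gamma>)"
          by (intro nn_integral_cong) (auto simp: indicator_def dist_commute)
        also have "\<dots> = indicator S y * emeasure (resolvent \<gamma>) (ball y (r n))"
          by (rule nn_integral_cmult_indicator) simp
        finally show "(\<integral>\<^sup>+z. indicator S y * indicator {p. dist (fst p) (snd p) < r n} (z, y) \<partial>resolvent \<gamma>) =
          indicator S y * emeasure (resolvent \<gamma>) (ball y (r n))" .
      qed
      \<comment> \<open>Off-centre balls of radius \<open>r n\<close> are compared with the centred
        ball of twice the radius, which is where the bound at \<open>2 * r n\<close> enters.\<close>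
      also have "\<dots> \<le> (\<integral>\<^sup>+y. indicator S y * (ennreal K * v n) \<partial>lborel)"
        unfolding v_def by (intro nn_integral_mono mult_left_mono order_trans[OF resolvent_ball_le[OF l] le]) auto
      also have "\<dots> = ennreal K * v n * emeasure lborel S"
        by (simp add: nn_integral_multc mult.commute)
      finally have "(\<integral>\<^sup>+z. u n z \<partial>resolvent \<gamma>) \<le> inverse (v n) * (ennreal K * v n * emeasure lborel S)"
        by (simp add: mult_left_mono)
      also have "\<dots> = ennreal K * (inverse (v n) * v n) * emeasure lborel S" by (simp only: mult_ac)
      finally show ?thesis by (simp add: inv)
    qed
    then have "liminf (\<lambda>n. \<integral>\<^sup>+z. u n z \<partial>resolvent \<gamma>) \<le> liminf (\<lambda>n::nat. ennreal K * emeasure lborel S)"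
      by (intro Liminf_mono always_eventually allI)
    then show ?thesis by (simp add: Liminf_const)
  qed
  finally show ?thesis .
qed

text \<open>Starting the clock at time \<open>s\<close> omits the occupation before
  \<open>s\<close>: potentials are excessive.\<close>

lemma potential_shift_le:
  assumes f[measurable]: "f \<in> borel_measurable borel" and s: "0 < s"
  shows "(\<integral>\<^sup>+\<omega>. U 0 f (X s \<omega>) \<partial>M) \<le> (\<integral>\<^sup>+z. f z \<partial>resolvent 0)"
proof -
  define p where "p u = (\<integral>\<^sup>+\<omega>. f (path u \<omega>) \<partial>M)" for u
  have [measurable]: "p \<in> borel_measurable borel" unfolding p_def by measurable
  have pX: "p u = (\<integral>\<^sup>+\<omega>. f (X u \<omega>) \<partial>M)" if "0 \<le> u" for u
    unfolding p_def using that by (rule nn_integral_path)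
  have "(\<integral>\<^sup>+\<omega>. U 0 f (X s \<omega>) \<partial>M) = (\<integral>\<^sup>+t. p (s + t) * indicator {0..} t \<partial>lborel)"
    unfolding nn_integral_shift_time[OF f s] using s
    by (intro nn_integral_cong) (auto simp: indicator_def pX)
  also have "\<dots> \<le> (\<integral>\<^sup>+t. p (s + t) * indicator {0..} (s + t) \<partial>lborel)"
    using s by (intro nn_integral_mono) (auto simp: indicator_def)
  also have "\<dots> = (\<integral>\<^sup>+t. p t * indicator {0..} t \<partial>lborel)"
    by (rule nn_integral_lborel_translate[of "\<lambda>t. p t * indicator {0..} t"]) measurable
  also have "\<dots> = (\<integral>\<^sup>+z. f z \<partial>resolvent 0)"
    unfolding nn_integral_resolvent_path[OF f] p_def by simp
  finally show ?thesis .
qed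

text \<open>For a step \<open>z\<close> in \<open>ball 0 r\<close>, the ball \<open>ball w r\<close>
  shifted by \<open>- z\<close> stays inside \<open>ball w (2 * r)\<close>. Integrating
  \<open>U \<gamma> Q\<close> over the larger ball thus collects the full integral over
  \<open>ball w r\<close> for every such \<open>z\<close>.\<close>

lemma lborel_ball_le_of_U_le:
  assumes Q[measurable]: "Q \<in> borel_measurable borel" and l: "\<gamma> > 0"
    and le: "\<And>x. U \<gamma> Q x \<le> S"
  shows "emeasure (resolvent \<gamma>) (ball 0 r) * (\<integral>\<^sup>+y\<in>ball w r. Q y \<partial>lborel) \<le>
    S * (2 ^ DIM('a) * emeasure lborel (ball (0 :: 'a) r))"
proof -
  interpret R: finite_measure "resolvent \<gamma>" by (rule finite_measure_resolvent) fact
  interpret pair_sigma_finite "resolvent \<gamma>" lborel ..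
  have [measurable]: "ball (y :: 'a) s \<in> sets borel" for y s by simp
  have "emeasure (resolvent \<gamma>) (ball 0 r) * (\<integral>\<^sup>+y\<in>ball w r. Q y \<partial>lborel) =
      (\<integral>\<^sup>+z. (\<integral>\<^sup>+y\<in>ball w r. Q y \<partial>lborel) * indicator (ball 0 r) z \<partial>resolvent \<gamma>)"
    by (subst nn_integral_cmult_indicator) (auto simp: mult.commute)
  also have "\<dots> \<le> (\<integral>\<^sup>+z. (\<integral>\<^sup>+x. Q (x + z) * indicator (ball w (2 * r)) x \<partial>lborel) \<partial>resolvent \<gamma>)"
  proof (rule nn_integral_mono)
    fix z
    show "(\<integral>\<^sup>+y\<in>ball w r. Q y \<partial>lborel) * indicator (ball 0 r) z \<le>
      (\<integral>\<^sup>+x. Q (x + z) * indicator (ball w (2 * r)) x \<partial>lborel)"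
    proof (cases "z \<in> ball 0 r")
      case True
      have "(\<integral>\<^sup>+y. Q y * indicator (ball w r) y \<partial>lborel) = (\<integral>\<^sup>+x. Q (z + x) * indicator (ball w r) (z + x) \<partial>lborel)"
        by (rule nn_integral_lborel_translate[symmetric]) measurable
      also have "\<dots> \<le> (\<integral>\<^sup>+x. Q (x + z) * indicator (ball w (2 * r)) x \<partial>lborel)"
      proof (rule nn_integral_mono)
        fix x
        have "dist w x < 2 * r" if "dist w (z + x) < r"
          using that True norm_triangle_ineq[of "w - (z + x)" z] by (simp add: dist_norm)
        then show "Q (z + x) * indicator (ball w r) (z + x) \<le> Q (x + z) * indicator (ball w (2 * r)) x"
          by (auto simp: indicator_def add.commute)
      qed
      finally show ?thesis using True by simp
    qed simp
  qed
  also have "\<dots> = (\<integral>\<^sup>+x. (\<integral>\<^sup>+z. Q (x + z) * indicator (ball w (2 * r)) x \<partial>resolvent \<gamma>) \<partial>lborel)"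
    by (rule Fubini'[symmetric]) measurable
  also have "\<dots> = (\<integral>\<^sup>+x. U \<gamma> Q x * indicator (ball w (2 * r)) x \<partial>lborel)"
    by (simp add: nn_integral_multc)
  also have "\<dots> \<le> (\<integral>\<^sup>+x. S * indicator (ball w (2 * r)) x \<partial>lborel)"
    by (intro nn_integral_mono mult_right_mono le) simp
  also have "\<dots> = S * emeasure lborel (ball w (2 * r))"
    by (simp add: nn_integral_cmult)
  finally show ?thesis by (simp only: emeasure_ball_double)
qed

end

section \<open>Potential density bounded away from the origin\<close>

locale levy_process_bounded_away = levy_process M X
  for M :: "'w measure" and X :: "real \<Rightarrow> 'w \<Rightarrow> 'a::euclidean_space" +
  fixes g :: "'a \<Rightarrow> ennreal"
  assumes g [measurable]: "g \<in> borel_measurable borel"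
    and density: "potential_measure M X = density lborel g"
    and bounded_away: "0 < r \<Longrightarrow> \<exists>C::real. AE z in lborel. r \<le> norm z \<longrightarrow> g z \<le> ennreal C"
begin

lemma resolvent_0: "resolvent 0 = density lborel g"
  using density by (simp add: potential_measure_eq_resolvent)

lemma potential_outside_le:
  fixes r :: real
  assumes "0 < r"
  obtains C where "0 \<le> C" "\<And>f. f \<in> borel_measurable borel \<Longrightarrow>
    (\<integral>\<^sup>+z\<in>- ball 0 r. f z \<partial>resolvent 0) \<le> ennreal C * (\<integral>\<^sup>+z. f z \<partial>lborel)"
proof -
  obtain C where C: "AE z in lborel. r \<le> norm z \<longrightarrow> g z \<le> ennreal C"
    using bounded_away assms by blast
  show thesis
  \<comment> \<open>The real bound supplied may be negative, where \<open>ennreal C\<close> is 0;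
    the maximum provides a nonnegative constant.\<close>
  proof (rule that[of "max 0 C"])
    fix f :: "'a \<Rightarrow> ennreal" assume [measurable]: "f \<in> borel_measurable borel"
    have [measurable]: "- ball (0::'a) r \<in> sets borel" by simp
    have "(\<integral>\<^sup>+z\<in>- ball 0 r. f z \<partial>resolvent 0) = (\<integral>\<^sup>+z. g z * (f z * indicator (- ball 0 r) z) \<partial>lborel)"
      unfolding resolvent_0 by (rule nn_integral_density) measurable
    also have "\<dots> \<le> (\<integral>\<^sup>+z. ennreal (max 0 C) * f z \<partial>lborel)"
    proof (rule nn_integral_mono_AE)
      have "ennreal C \<le> ennreal (max 0 C)" by (intro ennreal_leI) simp
      then have "g z * (f z * indicator (- ball 0 r) z) \<le> ennreal (max 0 C) * f z"
        if "r \<le> norm z \<longrightarrow> g z \<le> ennreal C" for z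
        using that order_trans[of "g z" "ennreal C" "ennreal (max 0 C)"]
        by (cases "r \<le> norm z") (simp_all add: mult_right_mono)
      with C show "AE z in lborel. g z * (f z * indicator (- ball 0 r) z) \<le> ennreal (max 0 C) * f z"
        by (rule eventually_mono)
    qed
    also have "\<dots> = ennreal (max 0 C) * (\<integral>\<^sup>+z. f z \<partial>lborel)" by (rule nn_integral_cmult) measurable
    finally show "(\<integral>\<^sup>+z\<in>- ball 0 r. f z \<partial>resolvent 0) \<le> ennreal (max 0 C) * (\<integral>\<^sup>+z. f z \<partial>lborel)" .
  qed simp
qed

section \<open>Finiteness of the potential near the origin\<close>

lemma potential_singleton: "emeasure (resolvent 0) {0} = 0"
proof -
  have "AE z in lborel. g z * indicator {0} z = 0"
    using AE_lborel_singleton[of "0::'a"] by eventually_elim simp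
  then show ?thesis unfolding resolvent_0 by (simp add: emeasure_density nn_integral_0_iff_AE)
qed

text \<open>If the process were almost surely 0 at each positive time, the potential would live on
  \<open>{0}\<close>, a null set for a measure with a density; yet its total mass is at least that
  of \<open>resolvent 1\<close>. The annuli between radii \<open>1 / n\<close> and \<open>n\<close>
  exhaust the nonzero displacements.\<close>

lemma nonzero_displacement:
  obtains s n where "0 < s" "0 < n" "0 < emeasure M {\<omega>\<in>space M. 1 / real n \<le> norm (X s \<omega>) \<and> norm (X s \<omega>) \<le> real n}"
proof -
  have "\<exists>s n. 0 < s \<and> 0 < n \<and> emeasure M {\<omega>\<in>space M. 1 / real n \<le> norm (X s \<omega>) \<and> norm (X s \<omega>) \<le> real n} \<noteq> 0"
  proof (rule ccontr)
    assume "\<not> ?thesis"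
    then have null: "emeasure M {\<omega>\<in>space M. 1 / real n \<le> norm (X s \<omega>) \<and> norm (X s \<omega>) \<le> real n} = 0"
      if "0 < s" "0 < n" for s n using that by blast
    have 0: "(\<integral>\<^sup>+\<omega>. indicator (- {0}) (X s \<omega>) \<partial>M) = 0" if s: "0 < s" for s
    proof -
      have [measurable]: "X s \<in> borel_measurable M" using s by (auto intro: random_variable_process)
      have "AE \<omega> in M. \<forall>n\<in>{0<..}. \<omega> \<notin> {\<omega>\<in>space M. 1 / real n \<le> norm (X s \<omega>) \<and> norm (X s \<omega>) \<le> real n}"
        using null[OF s] by (intro AE_ball_countable' AE_not_in) (auto simp: null_sets_def)
      then have "AE \<omega> in M. X s \<omega> = 0"
        using AE_space
      proof eventually_elim
        case (elim \<omega>)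
        show ?case
        proof (rule ccontr)
          assume nz: "X s \<omega> \<noteq> 0"
          obtain n where n: "max (norm (X s \<omega>)) (1 / norm (X s \<omega>)) < real n"
            using reals_Archimedean2 by blast
          then have "0 < real n" using norm_ge_zero[of "X s \<omega>"] by linarith
          then have "0 < n" "1 / real n \<le> norm (X s \<omega>)" "norm (X s \<omega>) \<le> real n"
            using n nz by (auto simp: field_simps)
          with elim show False by auto
        qed
      qed
      then show ?thesis by (subst nn_integral_0_iff_AE) (auto simp: indicator_def elim: eventually_mono)
    qed
    have "emeasure (resolvent 0) (- {0}) = (\<integral>\<^sup>+z. indicator (- {0}) z \<partial>resolvent 0)" by simp
    also have "\<dots> = (\<integral>\<^sup>+u\<in>{0..}. ennreal (exp (- 0 * u)) * (\<integral>\<^sup>+\<omega>. indicator (- {0}) (X u \<omega>) \<partial>M) \<partial>lborel)"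
      by (rule nn_integral_resolvent) simp
    also have "\<dots> = (\<integral>\<^sup>+u. 0 \<partial>(lborel :: real measure))"
    proof (rule nn_integral_cong_AE)
      show "AE u in lborel. ennreal (exp (- 0 * u)) * (\<integral>\<^sup>+\<omega>. indicator (- {0}) (X u \<omega>) \<partial>M) * indicator {0..} u = 0"
        using AE_lborel_singleton[of "0::real"] by eventually_elim (auto simp: indicator_def[of "{0..}"] 0)
    qed
    finally have "emeasure (resolvent 0) (- {0}) = 0" by simp
    moreover have "emeasure (resolvent 0) {0} + emeasure (resolvent 0) (- {0}) = emeasure (resolvent 0) UNIV"
      by (subst plus_emeasure) auto
    ultimately have "emeasure (resolvent 0) UNIV = 0" by (simp add: potential_singleton)
    moreover have "emeasure (resolvent 1) UNIV \<le> emeasure (resolvent 0) UNIV"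
      using resolvent_antimono[of "\<lambda>_. 1" 0 1] by simp
    ultimately show False by (simp add: emeasure_resolvent_UNIV)
  qed
  then obtain s n where sn: "0 < s" "0 < n"
    "emeasure M {\<omega>\<in>space M. 1 / real n \<le> norm (X s \<omega>) \<and> norm (X s \<omega>) \<le> real n} \<noteq> 0"
    by blast
  show thesis
    by (rule that[OF sn(1,2)]) (use sn(3) in \<open>simp only: zero_less_iff_neq_zero not_False_eq_True\<close>)
qed

text \<open>A positive fraction of the mass of the ball is carried by the semigroup at time \<open>s\<close> into a bounded
  region away from the origin, where the potential is finite because its density is bounded.\<close>

lemma potential_ball_finite: "emeasure (resolvent 0) (ball 0 1) < top"
proof -
  obtain s n where s: "0 < s" and n: "0 < (n::nat)"
    and pos: "0 < emeasure M {\<omega>\<in>space M. 1 / real n \<le> norm (X s \<omega>) \<and> norm (X s \<omega>) \<le> real n}" (is "0 < emeasure M ?E")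
    by (rule nonzero_displacement)
  \<comment> \<open>Half of the least displacement on \<open>?E\<close>: a point of
    \<open>ball 0 \<rho>\<close> moved by at least \<open>2 * \<rho>\<close> leaves that ball, yet
    stays within \<open>real n + 1\<close> of the origin.\<close>
  define \<rho> where "\<rho> = 1 / (2 * real n)"
  have \<rho>: "0 < \<rho>" "\<rho> \<le> 1" "1 / real n = 2 * \<rho>" using n by (auto simp: \<rho>_def field_simps)
  have [measurable]: "X s \<in> borel_measurable M" using s by (auto intro: random_variable_process)
  have [measurable]: "ball (0::'a) r \<in> sets borel" for r by simp
  obtain C where C: "0 \<le> C" "\<And>f. f \<in> borel_measurable borel \<Longrightarrow>
    (\<integral>\<^sup>+z\<in>- ball 0 \<rho>. f z \<partial>resolvent 0) \<le> ennreal C * (\<integral>\<^sup>+z. f z \<partial>lborel)"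
    using potential_outside_le[OF \<rho>(1)] by blast
  have outside: "(\<integral>\<^sup>+z. indicator (ball 0 r) z * indicator (- ball 0 \<rho>) z \<partial>resolvent 0) < top" for r
  proof -
    have "(\<integral>\<^sup>+z. indicator (ball 0 r) z * indicator (- ball 0 \<rho>) z \<partial>resolvent 0) \<le> ennreal C * emeasure lborel (ball (0::'a) r)"
      using C(2)[of "indicator (ball 0 r)"] by simp
    also have "\<dots> < top" using emeasure_lborel_ball_finite[of "0::'a" r] by (simp add: ennreal_mult_less_top)
    finally show ?thesis .
  qed
  let ?f = "\<lambda>z::'a. indicator (ball 0 (real n + 1)) z * indicator (- ball 0 \<rho>) z :: ennreal"
  have "emeasure M ?E * emeasure (resolvent 0) (ball 0 \<rho>) = (\<integral>\<^sup>+\<omega>. emeasure (resolvent 0) (ball 0 \<rho>) * indicator ?E \<omega> \<partial>M)"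
    by (subst nn_integral_cmult_indicator) (auto simp: mult.commute)
  also have "\<dots> \<le> (\<integral>\<^sup>+\<omega>. U 0 ?f (X s \<omega>) \<partial>M)"
  proof (rule nn_integral_mono)
    fix \<omega>
    show "emeasure (resolvent 0) (ball 0 \<rho>) * indicator ?E \<omega> \<le> U 0 ?f (X s \<omega>)"
    proof (cases "\<omega> \<in> ?E")
      case True
      have "emeasure (resolvent 0) (ball 0 \<rho>) = (\<integral>\<^sup>+z. indicator (ball 0 \<rho>) z \<partial>resolvent 0)" by simp
      also have "\<dots> \<le> U 0 ?f (X s \<omega>)"
      proof (rule nn_integral_mono)
        fix z
        show "indicator (ball 0 \<rho>) z \<le> ?f (X s \<omega> + z)"
        proof (cases "norm z < \<rho>")
          case z: True
          have "norm (X s \<omega> + z) < real n + 1" "\<rho> \<le> norm (X s \<omega> + z)"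
            using True z \<rho> norm_triangle_ineq[of "X s \<omega>" z] norm_triangle_ineq4[of "X s \<omega> + z" z] by auto
          then show ?thesis by (simp add: indicator_def)
        qed simp
      qed
      finally show ?thesis using True by simp
    qed simp
  qed
  also have "\<dots> \<le> (\<integral>\<^sup>+z. ?f z \<partial>resolvent 0)"
    by (rule potential_shift_le) (use s in measurable)
  also have "\<dots> < top" by (rule outside)
  finally have "emeasure (resolvent 0) (ball 0 \<rho>) < top"
    using pos by (auto simp: ennreal_mult_less_top)
  have "emeasure (resolvent 0) (ball 0 1) = (\<integral>\<^sup>+z. indicator (ball 0 1) z \<partial>resolvent 0)" by simp
  also have "\<dots> \<le> (\<integral>\<^sup>+z. indicator (ball 0 \<rho>) z + indicator (ball 0 1) z * indicator (- ball 0 \<rho>) z \<partial>resolvent 0)"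
    by (intro nn_integral_mono) (auto simp: indicator_def)
  also have "\<dots> = emeasure (resolvent 0) (ball 0 \<rho>) +
      (\<integral>\<^sup>+z. indicator (ball 0 1) z * indicator (- ball 0 \<rho>) z \<partial>resolvent 0)"
    by (subst nn_integral_add) auto
  also have "\<dots> < top" using \<open>emeasure (resolvent 0) (ball 0 \<rho>) < top\<close> outside by simp
  finally show ?thesis .
qed

text \<open>Continuity from above along balls shrinking to the null set \<open>{0}\<close>, made
  available by the finite mass of the unit ball.\<close>

lemma potential_small_ball:
  assumes "0 < e"
  obtains \<delta> where "0 < \<delta>" "emeasure (resolvent 0) (ball 0 \<delta>) \<le> ennreal e"
proof -
  define A where "A n = ball (0::'a) (1 / real (Suc n))" for n
  have "(\<lambda>n. emeasure (resolvent 0) (A n)) \<longlonglongrightarrow> emeasure (resolvent 0) (\<Inter>n. A n)"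
  proof (rule Lim_emeasure_decseq)
    show "decseq A" unfolding A_def decseq_def by (auto simp: field_simps intro!: subset_ball)
    fix n
    have "emeasure (resolvent 0) (A n) \<le> emeasure (resolvent 0) (ball 0 1)"
      unfolding A_def by (intro emeasure_mono subset_ball) auto
    then show "emeasure (resolvent 0) (A n) \<noteq> \<infinity>"
      using potential_ball_finite by (auto simp: top_unique)
  qed (auto simp: A_def)
  also have "(\<Inter>n. A n) = {0}"
  proof safe
    fix x assume x: "x \<in> (\<Inter>n. A n)"
    show "x = 0"
    proof (rule ccontr)
      assume "x \<noteq> 0"
      then obtain n where "inverse (real (Suc n)) < norm x" using reals_Archimedean[of "norm x"] by auto
      moreover have "norm x < 1 / real (Suc n)" using x by (auto simp: A_def)
      ultimately show False by (simp add: inverse_eq_divide)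
    qed
  qed (auto simp: A_def)
  finally have "\<forall>\<^sub>F n in sequentially. emeasure (resolvent 0) (A n) < ennreal e"
    unfolding potential_singleton using assms by (intro order_tendstoD(2)) auto
  then obtain n where "emeasure (resolvent 0) (A n) < ennreal e"
    by (auto simp: eventually_sequentially)
  then show thesis by (intro that[of "1 / real (Suc n)"]) (auto simp: A_def)
qed

section \<open>Resolvent mass of small balls under an unbounded potential density\<close>

text \<open>The resolvent equation at rate 0 recovers the potential from
  \<open>U \<gamma> (indicator S)\<close>. The pointwise bound on this function is used on the unit
  ball, whose potential is finite, and its Lebesgue integral is used outside, where the potential
  density is bounded.\<close>

lemma potential_open_le:
  assumes l: "\<gamma> > 0" and K: "0 \<le> K"
    and le: "\<And>S. open S \<Longrightarrow> emeasure (resolvent \<gamma>) S \<le> ennreal K * emeasure lborel S"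
  obtains C where "0 \<le> C" "\<And>S. open S \<Longrightarrow> emeasure (resolvent 0) S \<le> ennreal C * emeasure lborel S"
proof -
  obtain C where C: "0 \<le> C" "\<And>f. f \<in> borel_measurable borel \<Longrightarrow>
    (\<integral>\<^sup>+z\<in>- ball 0 1. f z \<partial>resolvent 0) \<le> ennreal C * (\<integral>\<^sup>+z. f z \<partial>lborel)"
    using potential_outside_le[of 1] by auto
  obtain G where G: "emeasure (resolvent 0) (ball 0 1) = ennreal G" "0 \<le> G"
    using potential_ball_finite by (cases "emeasure (resolvent 0) (ball 0 1)") auto
  show thesis
  \<comment> \<open>The first \<open>K\<close> comes from \<open>resolvent \<gamma>\<close> itself,
    \<open>K * G\<close> from the unit ball and \<open>C / \<gamma>\<close> from its
    complement.\<close>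
  proof (rule that[of "K + \<gamma> * (K * G + C / \<gamma>)"])
    show "0 \<le> K + \<gamma> * (K * G + C / \<gamma>)" using l K C G by simp
    fix S :: "'a set" assume S: "open S"
    let ?i = "indicator S :: 'a \<Rightarrow> ennreal"
    have [measurable]: "S \<in> sets borel" "ball (0::'a) 1 \<in> sets borel" using S by auto
    have [measurable]: "U \<gamma> ?i \<in> borel_measurable borel" using l by measurable
    have Ule: "U \<gamma> ?i y \<le> ennreal K * emeasure lborel S" for y
    proof -
      have op: "open ((\<lambda>z. y + z) -` S)" by (intro open_vimage S continuous_intros)
      have "U \<gamma> ?i y = (\<integral>\<^sup>+z. indicator ((\<lambda>z. y + z) -` S) z \<partial>resolvent \<gamma>)"
        by (intro nn_integral_cong) (auto simp: indicator_def)
      also have "\<dots> = emeasure (resolvent \<gamma>) ((\<lambda>z. y + z) -` S)" using op by simp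
      also have "\<dots> \<le> ennreal K * emeasure lborel ((\<lambda>z. y + z) -` S)" by (rule le) fact
      also have "emeasure lborel ((\<lambda>z. y + z) -` S) = (\<integral>\<^sup>+z. indicator ((\<lambda>z. y + z) -` S) z \<partial>lborel)"
        using op by simp
      also have "\<dots> = (\<integral>\<^sup>+z. ?i (y + z) \<partial>lborel)"
        by (intro nn_integral_cong) (auto simp: indicator_def)
      also have "\<dots> = emeasure lborel S" by (subst nn_integral_lborel_translate) auto
      finally show ?thesis .
    qed
    have "(\<integral>\<^sup>+y. U \<gamma> ?i y \<partial>resolvent 0) =
      (\<integral>\<^sup>+y. U \<gamma> ?i y * indicator (ball 0 1) y + U \<gamma> ?i y * indicator (- ball 0 1) y \<partial>resolvent 0)"
      by (intro nn_integral_cong) (auto simp: indicator_def)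
    also have "\<dots> = (\<integral>\<^sup>+y\<in>ball 0 1. U \<gamma> ?i y \<partial>resolvent 0) + (\<integral>\<^sup>+y\<in>- ball 0 1. U \<gamma> ?i y \<partial>resolvent 0)"
      by (rule nn_integral_add) measurable
    also have "\<dots> \<le> ennreal K * emeasure lborel S * ennreal G + ennreal C * (ennreal (1 / \<gamma>) * emeasure lborel S)"
    proof (rule add_mono)
      have "(\<integral>\<^sup>+y\<in>ball 0 1. U \<gamma> ?i y \<partial>resolvent 0) \<le> (\<integral>\<^sup>+y\<in>ball 0 1. (ennreal K * emeasure lborel S) \<partial>resolvent 0)"
        by (intro nn_integral_mono mult_right_mono Ule) simp
      also have "\<dots> = ennreal K * emeasure lborel S * ennreal G"
        by (subst nn_integral_cmult_indicator) (auto simp: G)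
      finally show "(\<integral>\<^sup>+y\<in>ball 0 1. U \<gamma> ?i y \<partial>resolvent 0) \<le> ennreal K * emeasure lborel S * ennreal G" .
      have "(\<integral>\<^sup>+y\<in>- ball 0 1. U \<gamma> ?i y \<partial>resolvent 0) \<le> ennreal C * (\<integral>\<^sup>+y. U \<gamma> ?i y \<partial>lborel)"
        by (rule C(2)) measurable
      also have "(\<integral>\<^sup>+y. U \<gamma> ?i y \<partial>lborel) = ennreal (1 / \<gamma>) * emeasure lborel S"
        using l by (subst lborel_integral_U) auto
      finally show "(\<integral>\<^sup>+y\<in>- ball 0 1. U \<gamma> ?i y \<partial>resolvent 0) \<le> ennreal C * (ennreal (1 / \<gamma>) * emeasure lborel S)" .
    qed
    finally have outer: "(\<integral>\<^sup>+y. U \<gamma> ?i y \<partial>resolvent 0) \<le>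
      ennreal K * emeasure lborel S * ennreal G + ennreal C * (ennreal (1 / \<gamma>) * emeasure lborel S)" .
    have "emeasure (resolvent 0) S = (\<integral>\<^sup>+z. ?i z \<partial>resolvent 0)" by simp
    also have "\<dots> = (\<integral>\<^sup>+z. ?i z \<partial>resolvent \<gamma>) + ennreal \<gamma> * (\<integral>\<^sup>+y. U \<gamma> ?i y \<partial>resolvent 0)"
      using resolvent_equation[of ?i 0 \<gamma>] l by simp
    also have "\<dots> \<le> ennreal K * emeasure lborel S +
      ennreal \<gamma> * (ennreal K * emeasure lborel S * ennreal G + ennreal C * (ennreal (1 / \<gamma>) * emeasure lborel S))"
      using le[OF S] by (intro add_mono mult_left_mono outer) simp_all
    also have "\<dots> = (ennreal K + ennreal \<gamma> * (ennreal K * ennreal G + ennreal C * ennreal (1 / \<gamma>))) * emeasure lborel S"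
      by (simp add: distrib_left distrib_right mult_ac)
    also have "ennreal K + ennreal \<gamma> * (ennreal K * ennreal G + ennreal C * ennreal (1 / \<gamma>)) = ennreal (K + \<gamma> * (K * G + C / \<gamma>))"
      using l K C G by (simp add: ennreal_mult[symmetric] ennreal_plus[symmetric] del: ennreal_plus)
    finally show "emeasure (resolvent 0) S \<le> ennreal (K + \<gamma> * (K * G + C / \<gamma>)) * emeasure lborel S" .
  qed
qed

text \<open>Small resolvent mass along radii tending to 0 would bound
  \<open>resolvent \<gamma>\<close>, and then the potential, by a multiple of Lebesgue measure on
  open sets; \<open>g\<close> would be essentially bounded.\<close>

lemma resolvent_ball_ge:
  assumes unbounded: "\<nexists>C::real. AE z in lborel. g z \<le> ennreal C"
    and l: "\<gamma> > 0" and K: "0 \<le> K"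
  obtains r where "0 < r" "\<And>s. 0 < s \<Longrightarrow> s < r \<Longrightarrow>
    ennreal K * emeasure lborel (ball (0::'a) s) \<le> emeasure (resolvent \<gamma>) (ball 0 s)"
proof -
  have "\<exists>r>0. \<forall>s. 0 < s \<longrightarrow> s < r \<longrightarrow> ennreal K * emeasure lborel (ball (0::'a) s) \<le> emeasure (resolvent \<gamma>) (ball 0 s)"
  proof (rule ccontr)
    assume "\<not> ?thesis"
    then have neg: "\<And>r. 0 < r \<Longrightarrow> \<exists>s. 0 < s \<and> s < r \<and>
        emeasure (resolvent \<gamma>) (ball 0 s) < ennreal K * emeasure lborel (ball (0::'a) s)"
      by (meson not_le)
    have "\<exists>s. 0 < s \<and> s < 1 / real (Suc n) \<and>
        emeasure (resolvent \<gamma>) (ball 0 s) < ennreal K * emeasure lborel (ball (0::'a) s)" for n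
      by (rule neg) simp
    then obtain s where s: "\<And>n. 0 < s n" "\<And>n. s n < 1 / real (Suc n)"
      "\<And>n. emeasure (resolvent \<gamma>) (ball 0 (s n)) < ennreal K * emeasure lborel (ball (0::'a) (s n))"
      by metis
    \<comment> \<open>The radii are halved because \<open>resolvent_open_le\<close> compares a
      doubled ball with the original one; the doubling costs a factor
      \<open>2 ^ DIM('a)\<close>.\<close>
    have s0: "(\<lambda>n. s n / 2) \<longlonglongrightarrow> 0"
    proof (rule tendsto_sandwich[of "\<lambda>_. 0" _ _ "\<lambda>n. 1 / real (Suc n)"])
      show "(\<lambda>n. 1 / real (Suc n)) \<longlonglongrightarrow> 0"
        using LIMSEQ_inverse_real_of_nat by (simp add: inverse_eq_divide)
      show "\<forall>\<^sub>F n in sequentially. s n / 2 \<le> 1 / real (Suc n)"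
      proof (intro always_eventually allI)
        fix n show "s n / 2 \<le> 1 / real (Suc n)" using s(1)[of n] s(2)[of n] by linarith
      qed
    qed (use s(1) in \<open>auto intro!: always_eventually less_imp_le\<close>)
    have "emeasure (resolvent \<gamma>) (ball 0 (2 * (s n / 2))) \<le> ennreal (K * 2 ^ DIM('a)) * emeasure lborel (ball (0::'a) (s n / 2))" for n
    proof -
      have "emeasure (resolvent \<gamma>) (ball 0 (2 * (s n / 2))) \<le> ennreal K * emeasure lborel (ball (0::'a) (2 * (s n / 2)))"
        using s(3)[of n] by simp
      also have "\<dots> = ennreal (K * 2 ^ DIM('a)) * emeasure lborel (ball (0::'a) (s n / 2))"
        unfolding emeasure_ball_double using K by (simp add: ennreal_mult ennreal_power[symmetric] mult.assoc del: ennreal_power)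
      finally show ?thesis .
    qed
    then have "emeasure (resolvent \<gamma>) S \<le> ennreal (K * 2 ^ DIM('a)) * emeasure lborel S" if "open S" for S
      using l s(1) that by (intro resolvent_open_le[OF l s0]) auto
    then obtain C where C: "0 \<le> C" "\<And>S. open S \<Longrightarrow> emeasure (resolvent 0) S \<le> ennreal C * emeasure lborel S"
      using potential_open_le[OF l, of "K * 2 ^ DIM('a)"] K by auto
    have "AE z in lborel. g z \<le> ennreal (C + 1)"
    proof (rule density_bounded[OF g C(1)])
      fix A :: "'a set" assume A: "A \<in> sets borel"
      show "emeasure (density lborel g) A \<le> ennreal C * emeasure lborel A"
        unfolding resolvent_0[symmetric] by (rule emeasure_le_of_open[OF sets_resolvent C(2) C(1) A])
    qed
    with unbounded show False by blast
  qed
  then show thesis using that by blast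
qed

text \<open>The resolvent equation yields three contributions of size \<open>e\<close>: the
  \<open>\<beta>\<close>-potential itself, and the parts of the iterated potential from inside and
  outside \<open>ball 0 \<delta>\<close>.\<close>

lemma potential_local_le_of_time:
  assumes unbounded: "\<nexists>C::real. AE z in lborel. g z \<le> ennreal C"
    and Q[measurable]: "Q \<in> borel_measurable borel"
    and time: "\<And>e. 0 < e \<Longrightarrow> \<exists>t>0. \<forall>x. (\<integral>\<^sup>+u\<in>{0..t}. (\<integral>\<^sup>+\<omega>. Q (x + X u \<omega>) \<partial>M) \<partial>lborel) \<le> ennreal e"
    and e: "0 < e"
  obtains r where "0 < r" "\<And>x. (\<integral>\<^sup>+z\<in>ball 0 r. Q (x + z) \<partial>resolvent 0) \<le> ennreal (3 * e)"
proof -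
  have [measurable]: "ball (y::'a) r \<in> sets borel" for y r by simp
  \<comment> \<open>The tolerance is halved because passing from short times to the resolvent
    doubles it.\<close>
  obtain t where t: "0 < t" "\<And>x. (\<integral>\<^sup>+u\<in>{0..t}. (\<integral>\<^sup>+\<omega>. Q (x + X u \<omega>) \<partial>M) \<partial>lborel) \<le> ennreal (e / 2)"
    using time[of "e / 2"] e by auto
  \<comment> \<open>At this rate the discount over time \<open>t\<close> is exactly one
    half.\<close>
  define \<beta> where "\<beta> = ln 2 / t"
  have \<beta>: "0 < \<beta>" "exp (- \<beta> * t) \<le> 1 / 2" using t(1) by (auto simp: \<beta>_def exp_minus)
  have UQ: "U \<beta> Q x \<le> ennreal e" for x
    using resolvent_le_of_time[OF Q \<beta>(1) t(1) \<beta>(2) t(2), of x] e by (simp add: ennreal_mult'[symmetric] flip: ennreal_numeral)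
  \<comment> \<open>The mass bound \<open>1 / \<beta>\<close> cancels the factor
    \<open>\<beta>\<close> in the resolvent equation.\<close>
  obtain \<delta> where \<delta>: "0 < \<delta>" "emeasure (resolvent 0) (ball 0 \<delta>) \<le> ennreal (1 / \<beta>)"
    using potential_small_ball[of "1 / \<beta>"] \<beta> by auto
  obtain C where C: "0 \<le> C" "\<And>f. f \<in> borel_measurable borel \<Longrightarrow>
    (\<integral>\<^sup>+z\<in>- ball 0 \<delta>. f z \<partial>resolvent 0) \<le> ennreal C * (\<integral>\<^sup>+z. f z \<partial>lborel)"
    using potential_outside_le[OF \<delta>(1)] by blast
  \<comment> \<open>The power of 2 offsets the doubled ball in
    \<open>lborel_ball_le_of_U_le\<close>; the factor \<open>C + 1\<close> compensates for the
    density bound \<open>C\<close> and stays positive when \<open>C = 0\<close>.\<close>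
  define K where "K = 2 ^ DIM('a) * (C + 1)"
  have K: "0 < K" using C by (simp add: K_def)
  obtain r where r: "0 < r" "\<And>s. 0 < s \<Longrightarrow> s < r \<Longrightarrow>
    ennreal K * emeasure lborel (ball (0::'a) s) \<le> emeasure (resolvent \<beta>) (ball 0 s)"
    using resolvent_ball_ge[OF unbounded \<beta>(1), of K] K by auto
  define s where "s = r / 2"
  have s: "0 < s" "s < r" using r(1) by (auto simp: s_def)
  have small: "ennreal C * (\<integral>\<^sup>+y\<in>ball x s. Q y \<partial>lborel) \<le> ennreal e" for x
  proof -
    let ?I = "\<integral>\<^sup>+y\<in>ball x s. Q y \<partial>lborel" and ?v = "emeasure lborel (ball (0::'a) s)"
    obtain v where v: "?v = ennreal v" "0 < v" using s(1) by (auto simp: emeasure_ball)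
    have "ennreal K * ?v * ?I \<le> emeasure (resolvent \<beta>) (ball 0 s) * ?I"
      by (intro mult_right_mono r(2) s) simp
    also have "\<dots> \<le> ennreal e * (2 ^ DIM('a) * ?v)"
      by (rule lborel_ball_le_of_U_le[OF Q \<beta>(1) UQ])
    finally have le: "ennreal K * ?v * ?I \<le> ennreal e * (2 ^ DIM('a) * ?v)" .
    define P where "P = (2::real) ^ DIM('a)"
    have P: "0 < P" "(2::ennreal) ^ DIM('a) = ennreal P"
      by (simp_all add: P_def ennreal_power[symmetric] del: ennreal_power)
    \<comment> \<open>Multiplication by \<open>a\<close> cancels the volume: it turns
      \<open>K * v\<close> into \<open>C + 1\<close> and the right-hand side into
      \<open>e\<close>.\<close>
    define a where "a = 1 / (P * v)"
    have a: "0 < a" "a * (e * (P * v)) = e" "a * (K * v) = C + 1"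
      using v P(1) by (simp_all add: a_def K_def P_def)
    have "ennreal (C + 1) * ?I = ennreal a * (ennreal K * ?v * ?I)"
      unfolding a(3)[symmetric] v(1) using a(1) K v(2) by (simp add: ennreal_mult mult.assoc)
    also have "\<dots> \<le> ennreal a * (ennreal e * (2 ^ DIM('a) * ?v))"
      by (intro mult_left_mono le) simp
    also have "\<dots> = ennreal (a * (e * (P * v)))"
      unfolding P(2) v(1) using a(1) e P(1) v(2) by (simp add: ennreal_mult)
    also have "\<dots> = ennreal e" unfolding a(2) ..
    finally have "ennreal (C + 1) * ?I \<le> ennreal e" .
    moreover have "ennreal C * ?I \<le> ennreal (C + 1) * ?I" by (intro mult_right_mono ennreal_leI) auto
    ultimately show ?thesis by (rule order_trans[rotated])
  qed
  show thesis
  proof (rule that[of s])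
    fix x
    define f where "f y = Q y * indicator (ball x s) y" for y
    have f[measurable]: "f \<in> borel_measurable borel" unfolding f_def by measurable
    have [measurable]: "U \<beta> f \<in> borel_measurable borel" using \<beta>(1) by measurable
    have Uf: "U \<beta> f y \<le> ennreal e" for y
      by (rule order_trans[OF nn_integral_mono UQ[of y]]) (auto simp: f_def indicator_def)
    have "U 0 (U \<beta> f) x =
      (\<integral>\<^sup>+y. U \<beta> f (x + y) * indicator (ball 0 \<delta>) y + U \<beta> f (x + y) * indicator (- ball 0 \<delta>) y \<partial>resolvent 0)"
      by (intro nn_integral_cong) (auto simp: indicator_def)
    also have "\<dots> = (\<integral>\<^sup>+y\<in>ball 0 \<delta>. U \<beta> f (x + y) \<partial>resolvent 0) + (\<integral>\<^sup>+y\<in>- ball 0 \<delta>. U \<beta> f (x + y) \<partial>resolvent 0)"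
      by (rule nn_integral_add) measurable
    also have "\<dots> \<le> ennreal e * ennreal (1 / \<beta>) + ennreal (1 / \<beta>) * ennreal e"
    proof (rule add_mono)
      have "(\<integral>\<^sup>+y\<in>ball 0 \<delta>. U \<beta> f (x + y) \<partial>resolvent 0) \<le> (\<integral>\<^sup>+y\<in>ball 0 \<delta>. ennreal e \<partial>resolvent 0)"
        by (intro nn_integral_mono mult_right_mono Uf) simp
      also have "\<dots> = ennreal e * emeasure (resolvent 0) (ball 0 \<delta>)"
        by (subst nn_integral_cmult_indicator) auto
      also have "\<dots> \<le> ennreal e * ennreal (1 / \<beta>)" by (intro mult_left_mono \<delta>) simp
      finally show "(\<integral>\<^sup>+y\<in>ball 0 \<delta>. U \<beta> f (x + y) \<partial>resolvent 0) \<le> ennreal e * ennreal (1 / \<beta>)" .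
      have "(\<integral>\<^sup>+y\<in>- ball 0 \<delta>. U \<beta> f (x + y) \<partial>resolvent 0) \<le> ennreal C * (\<integral>\<^sup>+y. U \<beta> f (x + y) \<partial>lborel)"
        by (rule C(2)) measurable
      also have "(\<integral>\<^sup>+y. U \<beta> f (x + y) \<partial>lborel) = ennreal (1 / \<beta>) * (\<integral>\<^sup>+y. f y \<partial>lborel)"
        using \<beta>(1) by (subst nn_integral_lborel_translate) (auto simp: lborel_integral_U)
      also have "ennreal C * \<dots> = ennreal (1 / \<beta>) * (ennreal C * (\<integral>\<^sup>+y\<in>ball x s. Q y \<partial>lborel))"
        by (simp add: f_def mult_ac)
      also have "\<dots> \<le> ennreal (1 / \<beta>) * ennreal e" by (intro mult_left_mono small) simp
      finally show "(\<integral>\<^sup>+y\<in>- ball 0 \<delta>. U \<beta> f (x + y) \<partial>resolvent 0) \<le> ennreal (1 / \<beta>) * ennreal e" .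
    qed
    finally have outer: "U 0 (U \<beta> f) x \<le> ennreal e * ennreal (1 / \<beta>) + ennreal (1 / \<beta>) * ennreal e" .
    have "(\<integral>\<^sup>+z\<in>ball 0 s. Q (x + z) \<partial>resolvent 0) = U 0 f x"
      by (intro nn_integral_cong) (auto simp: f_def indicator_def dist_norm)
    also have "\<dots> = U \<beta> f x + ennreal \<beta> * U 0 (U \<beta> f) x"
      using U_equation[OF f, of 0 \<beta> x] \<beta>(1) by simp
    also have "\<dots> \<le> ennreal e + ennreal \<beta> * (ennreal e * ennreal (1 / \<beta>) + ennreal (1 / \<beta>) * ennreal e)"
      by (intro add_mono mult_left_mono Uf outer) simp
    also have "\<dots> = ennreal (3 * e)"
      using \<beta>(1) e by (simp add: ennreal_mult[symmetric] ennreal_plus[symmetric] del: ennreal_plus) 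
    finally show "(\<integral>\<^sup>+z\<in>ball 0 s. Q (x + z) \<partial>resolvent 0) \<le> ennreal (3 * e)" .
  qed (rule s)
qed

end

section \<open>The three Kato classes\<close>

context levy_process
begin

lemma kato_class_0_iff:
  "q \<in> kato_class_0 M X \<longleftrightarrow> q \<in> borel_measurable borel \<and>
    (\<forall>e>0. \<exists>r>0. \<forall>x. (\<integral>\<^sup>+z\<in>ball 0 r. ennreal \<bar>q (x + z)\<bar> \<partial>resolvent 0) \<le> ennreal e)"
  unfolding kato_class_0_def potential_measure_eq_resolvent mem_Collect_eq
  by (subst tendsto_at_right_0_SUP_iff) (auto intro!: nn_integral_mono simp: indicator_def add.commute)

lemma kato_class_time_iff:
  "q \<in> kato_class_time M X \<longleftrightarrow> q \<in> borel_measurable borel \<and>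
    (\<forall>e>0. \<exists>t>0. \<forall>x. (\<integral>\<^sup>+u\<in>{0..t}. (\<integral>\<^sup>+\<omega>. ennreal \<bar>q (x + X u \<omega>)\<bar> \<partial>M) \<partial>lborel) \<le> ennreal e)"
proof -
  have eq: "(\<integral>\<^sup>+\<omega>. (\<integral>\<^sup>+u\<in>{0..t}. ennreal \<bar>q (x + X u \<omega>)\<bar> \<partial>lborel) \<partial>M) =
      (\<integral>\<^sup>+u\<in>{0..t}. (\<integral>\<^sup>+\<omega>. ennreal \<bar>q (x + X u \<omega>)\<bar> \<partial>M) \<partial>lborel)"
    if [measurable]: "q \<in> borel_measurable borel" for t x
  proof -
    \<comment> \<open>The window \<open>{0..t}\<close> becomes a weight on \<open>{0..}\<close>, the
      form handled by \<open>nn_integral_weighted_time\<close>.\<close>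
    have i: "(\<integral>\<^sup>+u\<in>{0..t}. F u \<partial>lborel) = (\<integral>\<^sup>+u\<in>{0..}. indicator {..t} u * F u \<partial>lborel)" for F
      by (intro nn_integral_cong) (auto simp: indicator_def)
    show ?thesis
      unfolding i by (rule nn_integral_weighted_time[of "\<lambda>z. ennreal \<bar>q (x + z)\<bar>"]) measurable
  qed
  have lim: "((\<lambda>t. SUP x. \<integral>\<^sup>+\<omega>. (\<integral>\<^sup>+u\<in>{0..t}. ennreal \<bar>q (x + X u \<omega>)\<bar> \<partial>lborel) \<partial>M) \<longlongrightarrow> 0) (at_right 0) \<longleftrightarrow>
    (\<forall>e>0. \<exists>t>0. \<forall>x. (\<integral>\<^sup>+\<omega>. (\<integral>\<^sup>+u\<in>{0..t}. ennreal \<bar>q (x + X u \<omega>)\<bar> \<partial>lborel) \<partial>M) \<le> ennreal e)"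
    by (rule tendsto_at_right_0_SUP_iff) (auto intro!: nn_integral_mono simp: indicator_def)
  show ?thesis
  proof (cases "q \<in> borel_measurable borel")
    case True
    show ?thesis by (simp only: kato_class_time_def mem_Collect_eq eq[OF True] lim[unfolded eq[OF True]])
  qed (simp add: kato_class_time_def)
qed

lemma kato_class_space_iff:
  "q \<in> kato_class_space M X \<longleftrightarrow> q \<in> borel_measurable borel \<and>
    (\<exists>\<alpha>>0. \<forall>e>0. \<exists>r>0. \<forall>x. (\<integral>\<^sup>+z\<in>ball 0 r. ennreal \<bar>q (x + z)\<bar> \<partial>resolvent \<alpha>) \<le> ennreal e)"
proof -
  let ?L = "\<lambda>\<alpha> r x. \<integral>\<^sup>+\<omega>. (\<integral>\<^sup>+u\<in>{0..}.
          ennreal (exp (- \<alpha> * u)) * indicator (ball x r) (x + X u \<omega>) * ennreal \<bar>q (x + X u \<omega>)\<bar>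
        \<partial>lborel) \<partial>M"
  have eq: "?L \<alpha> r x = (\<integral>\<^sup>+z\<in>ball 0 r. ennreal \<bar>q (x + z)\<bar> \<partial>resolvent \<alpha>)"
    if [measurable]: "q \<in> borel_measurable borel" for \<alpha> r x
  proof -
    let ?f = "\<lambda>z. ennreal \<bar>q (x + z)\<bar> * indicator (ball 0 r) z"
    have [measurable]: "ball (0::'a) r \<in> sets borel" by simp
    have f: "?f \<in> borel_measurable borel" by measurable
    have "?L \<alpha> r x = (\<integral>\<^sup>+\<omega>. (\<integral>\<^sup>+u\<in>{0..}. ennreal (exp (- \<alpha> * u)) * ?f (X u \<omega>) \<partial>lborel) \<partial>M)"
      by (intro nn_integral_cong) (auto simp: indicator_def dist_norm)
    also have "\<dots> = (\<integral>\<^sup>+u\<in>{0..}. ennreal (exp (- \<alpha> * u)) * (\<integral>\<^sup>+\<omega>. ?f (X u \<omega>) \<partial>M) \<partial>lborel)"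
      by (rule nn_integral_weighted_time[OF f]) measurable
    also have "\<dots> = (\<integral>\<^sup>+z. ?f z \<partial>resolvent \<alpha>)"
      by (rule nn_integral_resolvent[OF f, symmetric])
    finally show ?thesis .
  qed
  have lim: "((\<lambda>r. SUP x. ?L \<alpha> r x) \<longlongrightarrow> 0) (at_right 0) \<longleftrightarrow> (\<forall>e>0. \<exists>r>0. \<forall>x. ?L \<alpha> r x \<le> ennreal e)" for \<alpha>
    by (rule tendsto_at_right_0_SUP_iff) (auto intro!: nn_integral_mono simp: indicator_def)
  show ?thesis
  proof (cases "q \<in> borel_measurable borel")
    case True
    show ?thesis by (simp only: kato_class_space_def mem_Collect_eq eq[OF True] lim[unfolded eq[OF True]])
  qed (simp add: kato_class_space_def)
qed

text \<open>Discounting only decreases the measure, so rate 1 serves as witness.\<close>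

lemma kato_class_0_subset_space: "kato_class_0 M X \<subseteq> kato_class_space M X"
proof
  fix q assume "q \<in> kato_class_0 M X"
  then have q[measurable]: "q \<in> borel_measurable borel"
    and small: "\<And>e. 0 < e \<Longrightarrow> \<exists>r>0. \<forall>x. (\<integral>\<^sup>+z\<in>ball 0 r. ennreal \<bar>q (x + z)\<bar> \<partial>resolvent 0) \<le> ennreal e"
    by (auto simp: kato_class_0_iff)
  have le: "(\<integral>\<^sup>+z\<in>ball 0 r. ennreal \<bar>q (x + z)\<bar> \<partial>resolvent 1) \<le> (\<integral>\<^sup>+z\<in>ball 0 r. ennreal \<bar>q (x + z)\<bar> \<partial>resolvent 0)" for r x
  proof (rule resolvent_antimono)
    have [measurable]: "ball (0::'a) r \<in> sets borel" by simp
    show "(\<lambda>z. ennreal \<bar>q (x + z)\<bar> * indicator (ball 0 r) z) \<in> borel_measurable borel" by measurable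
  qed simp
  show "q \<in> kato_class_space M X"
    unfolding kato_class_space_iff
    using q small order_trans[OF le] by (intro conjI exI[of _ 1]) (auto, meson)
qed

text \<open>A local bound at one rate persists at larger rates. A large rate concentrates the kernel
  near its starting point, which makes the bound global, and a global bound at rate
  \<open>\<gamma>\<close> controls the time interval of length \<open>1 / \<gamma>\<close>.\<close>

lemma kato_class_space_subset_time: "kato_class_space M X \<subseteq> kato_class_time M X"
proof
  fix q assume "q \<in> kato_class_space M X"
  then obtain \<alpha> where q[measurable]: "q \<in> borel_measurable borel" and \<alpha>: "0 < \<alpha>"
    and small: "\<And>e. 0 < e \<Longrightarrow> \<exists>r>0. \<forall>x. (\<integral>\<^sup>+z\<in>ball 0 r. ennreal \<bar>q (x + z)\<bar> \<partial>resolvent \<alpha>) \<le> ennreal e"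
    by (auto simp: kato_class_space_iff)
  have "\<exists>t>0. \<forall>x. (\<integral>\<^sup>+u\<in>{0..t}. (\<integral>\<^sup>+\<omega>. ennreal \<bar>q (x + X u \<omega>)\<bar> \<partial>M) \<partial>lborel) \<le> ennreal e" if e: "0 < e" for e
  proof -
    \<comment> \<open>The factor 2 is lost in passing from the local to the global bound, and
      \<open>exp 1\<close> in passing to the time horizon \<open>1 / \<gamma>\<close>.\<close>
    define e' where "e' = e / (2 * exp 1)"
    have e': "0 < e'" using e by (simp add: e'_def)
    obtain r where r: "0 < r" "\<And>x. (\<integral>\<^sup>+z\<in>ball 0 r. ennreal \<bar>q (x + z)\<bar> \<partial>resolvent \<alpha>) \<le> ennreal e'"
      using small[OF e'] by blast
    obtain L where L: "0 < L" "\<And>\<gamma>. L \<le> \<gamma> \<Longrightarrow> ennreal \<gamma> * emeasure (resolvent \<gamma>) (- ball 0 (r / 2)) \<le> ennreal (1 / 4)"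
      using resolvent_outside_ball[of "r / 2" "1 / 4"] r(1) by auto
    \<comment> \<open>At least \<open>\<alpha>\<close>, so that the local bound carries over, and at
      least \<open>L\<close>, so that little mass lies outside the half ball.\<close>
    define \<gamma> where "\<gamma> = max L \<alpha>"
    have \<gamma>: "0 < \<gamma>" "\<alpha> \<le> \<gamma>" "L \<le> \<gamma>" using \<alpha> by (auto simp: \<gamma>_def)
    have U: "U \<gamma> (\<lambda>y. ennreal \<bar>q y\<bar>) x \<le> 2 * ennreal e'" for x
    proof (rule resolvent_le_of_local[OF _ \<gamma>(1) L(2)[OF \<gamma>(3)]])
      fix x
      have [measurable]: "ball (0::'a) r \<in> sets borel" by simp
      have "(\<integral>\<^sup>+z\<in>ball 0 r. ennreal \<bar>q (x + z)\<bar> \<partial>resolvent \<gamma>) \<le> (\<integral>\<^sup>+z\<in>ball 0 r. ennreal \<bar>q (x + z)\<bar> \<partial>resolvent \<alpha>)"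
        by (rule resolvent_antimono[OF _ \<gamma>(2)]) measurable
      then show "(\<integral>\<^sup>+z\<in>ball 0 r. ennreal \<bar>q (x + z)\<bar> \<partial>resolvent \<gamma>) \<le> ennreal e'"
        using r(2) by (rule order_trans)
    qed measurable
    have "(\<integral>\<^sup>+u\<in>{0..1 / \<gamma>}. (\<integral>\<^sup>+\<omega>. ennreal \<bar>q (x + X u \<omega>)\<bar> \<partial>M) \<partial>lborel) \<le> ennreal e" for x
    proof -
      have "(\<integral>\<^sup>+u\<in>{0..1 / \<gamma>}. (\<integral>\<^sup>+\<omega>. ennreal \<bar>q (x + X u \<omega>)\<bar> \<partial>M) \<partial>lborel) \<le>
          ennreal (exp (\<gamma> * (1 / \<gamma>))) * U \<gamma> (\<lambda>y. ennreal \<bar>q y\<bar>) x"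
        using \<gamma>(1) by (intro time_le_resolvent) auto
      also have "\<dots> \<le> ennreal (exp (\<gamma> * (1 / \<gamma>))) * (2 * ennreal e')"
        by (intro mult_left_mono U) simp
      also have "2 * ennreal e' = ennreal (2 * e')" using e' by (simp add: ennreal_mult)
      also have "ennreal (exp (\<gamma> * (1 / \<gamma>))) * ennreal (2 * e') = ennreal e"
        using \<gamma>(1) e by (simp add: ennreal_mult[symmetric] e'_def)
      finally show ?thesis .
    qed
    then show ?thesis using \<gamma>(1) by (intro exI[of _ "1 / \<gamma>"]) simp
  qed
  then show "q \<in> kato_class_time M X" by (simp add: kato_class_time_iff)
qed

end

lemma (in levy_process_bounded_away) kato_class_time_subset_0:
  assumes unbounded: "\<nexists>C::real. AE z in lborel. g z \<le> ennreal C"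
  shows "kato_class_time M X \<subseteq> kato_class_0 M X"
proof
  fix q assume "q \<in> kato_class_time M X"
  then have q[measurable]: "q \<in> borel_measurable borel"
    and time: "\<And>e. 0 < e \<Longrightarrow> \<exists>t>0. \<forall>x. (\<integral>\<^sup>+u\<in>{0..t}. (\<integral>\<^sup>+\<omega>. ennreal \<bar>q (x + X u \<omega>)\<bar> \<partial>M) \<partial>lborel) \<le> ennreal e"
    by (auto simp: kato_class_time_iff)
  have "\<exists>r>0. \<forall>x. (\<integral>\<^sup>+z\<in>ball 0 r. ennreal \<bar>q (x + z)\<bar> \<partial>resolvent 0) \<le> ennreal e" if e: "0 < e" for e
  proof -
    obtain r where "0 < r" "\<And>x. (\<integral>\<^sup>+z\<in>ball 0 r. ennreal \<bar>q (x + z)\<bar> \<partial>resolvent 0) \<le> ennreal (3 * (e / 3))"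
      by (rule potential_local_le_of_time[of "\<lambda>y. ennreal \<bar>q y\<bar>" "e / 3"]) (use unbounded time e in auto)
    then show ?thesis by auto
  qed
  then show "q \<in> kato_class_0 M X" by (simp add: kato_class_0_iff)
qed

theorem theorem4p15:
  fixes M :: "'w measure" and X :: "real \<Rightarrow> 'w \<Rightarrow> real ^ 'd"
    and g :: "real ^ 'd \<Rightarrow> ennreal"
  assumes "levy_process M X"
    and "transient_process M X"
    and "g \<in> borel_measurable borel"
    and "potential_measure M X = density lborel g"
    and "\<nexists>C::real. AE z in lborel. g z \<le> ennreal C"
    and "\<And>r::real. 0 < r \<Longrightarrow> \<exists>C::real. AE z in lborel. r \<le> norm z \<longrightarrow> g z \<le> ennreal C"
  shows "kato_class_0 M X = kato_class_space M X \<and> kato_class_space M X = kato_class_time M X"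
proof -
  interpret levy_process M X by fact
  interpret levy_process_bounded_away M X g
    by unfold_locales (use assms(3,4,6) in auto)
  show ?thesis
    using kato_class_0_subset_space kato_class_space_subset_time kato_class_time_subset_0[OF assms(5)]
    by blast
qed

end
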